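(* Let $d,r,s$ be positive integers, let $b_0,\tilde b_0\in (l_0(\mathbb{Z}^d))^{r\times r}$, $b_1,\dots,b_s,\tilde b_1,\dots,\tilde b_s\in (l_0(\mathbb{Z}^d))^{1\times r}$, and let $\mathsf M_0,\dots,\mathsf M_s$ be $d\times d$ dilation matrices such that $(\{b_l!\mathsf M_l\}_{l=0}^s,\{\tilde b_l!\mathsf M_l\}_{l=0}^s)$ is a dual framelet filter bank with mixed dilation factors. Let $0<C_1\le C_2<\infty$. For each $J\in\mathbb N$ let $\mathcal W_J$ and $\mathcal V_J$ (resp. $\tilde{\mathcal W}_J$ and $\tilde{\mathcal V}_J$) be the $J$-level discrete framelet analysis and synthesis operators employing the filter bank $\{b_l!\mathsf M_l\}_{l=0}^s$ (resp. $\{\tilde b_l!\mathsf M_l\}_{l=0}^s$). The following statements are equivalent (norms of operators being operator norms between the corresponding $l_2$ spaces): (1) $\{b_l!\mathsf M_l\}_{l=0}^s$ and $\{\tilde b_l!\mathsf M_l\}_{l=0}^s$ have stability in $l_2(\mathbb{Z}^d)$, with $$C_1\|v\|^2\le\|\mathcal W_Jv\|^2\le C_2\|v\|^2\quad\text{and}\quad C_2^{-1}\|v\|^2\le\|\tilde{\mathcal W}_Jv\|^2\le C_1^{-1}\|v\|^2$$ for all $J\in\mathbb N$ and $v\in(l_2(\mathbb{Z}^d))^{1\times r}$. (2) $\|\mathcal W_J\|^2\le C_2$ and $\|\tilde{\mathcal W}_J\|^2\le C_1^{-1}$ for all $J\in\mathbb N$. (3) $\|\mathcal V_J\|^2\le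 C_2$ and $\|\tilde{\mathcal V}_J\|^2\le C_1^{-1}$ for all $J\in\mathbb N$. (4) $\|\mathcal V_J\|^2\le C_2$ and $\|\tilde{\mathcal W}_J\|^2\le C_1^{-1}$ for all $J\in\mathbb N$. (5) $\|\mathcal W_J\|^2\le C_2$ and $\|\tilde{\mathcal V}_J\|^2\le C_1^{-1}$ for all $J\in\mathbb N$.
   Context: A $d\times d$ dilation matrix is an integer matrix all of whose eigenvalues have modulus greater than $1$. $(l_0(\mathbb{Z}^d))^{p\times q}$: finitely supported sequences $\mathbb{Z}^d\to\mathbb{C}^{p\times q}$; $(l_2(\mathbb{Z}^d))^{p\times q}$: square-summable ones, with $\|u\|^2$ the sum of squared moduli of all entries. $\widehat u(\xi):=\sum_{k}u(k)e^{-ik\cdot\xi}$; $\overline A^{\mathsf T}$ is the conjugate transpose; $\boldsymbol\delta(0)=1$, $\boldsymbol\delta(x)=0$ for $x\neq0$. Dual framelet filter bank with mixed dilation factors: with $\Omega_l:=[\mathsf M_l^{-\mathsf T}\mathbb{Z}^d]\cap[0,1)^d$ and $\chi_E$ the indicator function of $E$, $\sum_{l=0}^s\chi_{\Omega_l}(\omega)\overline{\widehat{b_l}(\xi)}^{\mathsf T}\widehat{\tilde b_l}(\xi+2\pi\omega)=\boldsymbol\delta(\omega)I_r$ for a.e. $\xi\in\mathbb{R}^d$ and all $\omega\in\bigcup_{l=0}^s\Omega_l$. Subdivision operator: $[\mathcal S_{a,\mathsf M}u](n):=|\det(\mathsf M)|^{1/2}\sum_{k\in\mathbb{Z}^d}u(k)a(n-\mathsf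 Mk)$. Transition operator: $[\mathcal T_{b,\mathsf M}u](n):=|\det(\mathsf M)|^{1/2}\sum_{k\in\mathbb{Z}^d}u(k)\overline{b(k-\mathsf Mn)}^{\mathsf T}$. $J$-level analysis operator employing $\{b_l!\mathsf M_l\}_{l=0}^s$: $\mathcal W_Jv:=(v_{1,1},\dots,v_{s,1},\dots,v_{1,J},\dots,v_{s,J},v_{0,J})$, where $v_{0,0}:=v$ is $1\times r$-valued and $v_{l,j}:=\mathcal T_{b_l,\mathsf M_l}v_{0,j-1}$ for $l=0,\dots,s$, $j=1,\dots,J$; it maps $(l_2(\mathbb{Z}^d))^{1\times r}$ to $(l_2(\mathbb{Z}^d))^{1\times(sJ+r)}$. $J$-level synthesis operator employing $\{b_l!\mathsf M_l\}_{l=0}^s$: $\mathcal V_J(w_{1,1},\dots,w_{s,1},\dots,w_{1,J},\dots,w_{s,J},w_{0,J}):=w_{0,0}$, where recursively $w_{0,j-1}:=\sum_{l=0}^s\mathcal S_{b_l,\mathsf M_l}w_{l,j}$ for $j=J,\dots,1$ ($w_{l,j}$ scalar-valued for $l\ge1$, $w_{0,J}$ $1\times r$-valued). $\tilde{\mathcal W}_J,\tilde{\mathcal V}_J$ are defined in the same way from $\tilde b_l$. Stability in $l_2(\mathbb{Z}^d)$ of a filter bank $\{b_l!\mathsf M_l\}_{l=0}^s$: there exist positive constants $c_1,c_2$ with $c_1\|v\|^2\le\|\mathcal W_Jv\|^2\le c_2\|v\|^2$ for all $J\in\mathbb N$ and $v\in(l_2(\mathbb{Z}^d))^{1\times r}$.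 *)

theory Defs
  imports "HOL-Analysis.Analysis"
begin

text \<open>
  \<open>\<int>\<^sup>d\<close> is \<^typ>\<open>int^'d\<close>, and a \<open>p \<times> q\<close> complex matrix is a \<^typ>\<open>complex^'q^'p\<close>.
  A sequence of \<open>1 \<times> n\<close> row vectors is a function \<^typ>\<open>int^'d \<Rightarrow> complex^'n\<close>, and matrices
  act on such rows from the right by \<open>v*\<close>.
  A filter bank is given by its low-pass filter \<open>b0\<close> (\<open>r \<times> r\<close>), its high-pass filters
  \<open>b 1, \<dots>, b s\<close> (\<open>1 \<times> r\<close>, so that their coefficients are rows of length \<open>1\<close>), and its
  dilation matrices \<open>M 0, \<dots>, M s\<close>. The values of \<open>b\<close> and \<open>M\<close> at other indices are
  irrelevant.
\<close>

definition dilation_matrix :: "int^'d^'d \<Rightarrow> bool" where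
  "dilation_matrix M \<longleftrightarrow>
    (\<forall>(z::complex) x. x \<noteq> 0 \<and> map_matrix of_int M *v x = z *s x \<longrightarrow> cmod z > 1)"

definition fin_supp :: "(int^'d \<Rightarrow> complex^'q^'p) \<Rightarrow> bool" where
  "fin_supp u \<longleftrightarrow> finite {k. u k \<noteq> 0}"

definition int_to_real_vec :: "int^'d \<Rightarrow> real^'d" where
  "int_to_real_vec k = (\<chi> i. real_of_int (k $ i))"

definition conj_transpose :: "complex^'q^'p \<Rightarrow> complex^'p^'q" where
  "conj_transpose A = (\<chi> i j. cnj (A $ j $ i))"

definition fourier_series :: "(int^'d \<Rightarrow> complex^'q^'p) \<Rightarrow> real^'d \<Rightarrow> complex^'q^'p" where
  "fourier_series u \<xi> =
    (\<chi> i j. \<Sum>\<^sub>\<infinity>k. u k $ i $ j * exp (- \<i> * complex_of_real (int_to_real_vec k \<bullet> \<xi>)))"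

definition \<Omega> :: "int^'d^'d \<Rightarrow> (real^'d) set" where
  "\<Omega> M = range (\<lambda>k. matrix_inv (transpose (map_matrix real_of_int M)) *v int_to_real_vec k)
          \<inter> {x. \<forall>i. 0 \<le> x $ i \<and> x $ i < 1}"

definition dual_framelet_filter_bank ::
  "nat \<Rightarrow> (nat \<Rightarrow> int^'d^'d) \<Rightarrow>
    (int^'d \<Rightarrow> complex^'r^'r) \<Rightarrow> (nat \<Rightarrow> int^'d \<Rightarrow> complex^'r^1) \<Rightarrow>
    (int^'d \<Rightarrow> complex^'r^'r) \<Rightarrow> (nat \<Rightarrow> int^'d \<Rightarrow> complex^'r^1) \<Rightarrow> bool" where
  "dual_framelet_filter_bank s M b0 b b0' b' \<longleftrightarrow>
    (AE \<xi> in lborel. \<forall>\<omega> \<in> (\<Union>l\<le>s. \<Omega> (M l)).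
      indicat_real (\<Omega> (M 0)) \<omega> *\<^sub>R
        (conj_transpose (fourier_series b0 \<xi>) ** fourier_series b0' (\<xi> + (2 * pi) *\<^sub>R \<omega>)) +
      (\<Sum>l=1..s. indicat_real (\<Omega> (M l)) \<omega> *\<^sub>R
        (conj_transpose (fourier_series (b l) \<xi>) ** fourier_series (b' l) (\<xi> + (2 * pi) *\<^sub>R \<omega>)))
      = (if \<omega> = 0 then mat 1 else 0))"

definition l2 :: "(int^'d \<Rightarrow> complex^'n) set" where
  "l2 = {v. (\<lambda>k. (norm (v k))\<^sup>2) summable_on UNIV}"

definition l2_norm :: "(int^'d \<Rightarrow> complex^'n) \<Rightarrow> real" where
  "l2_norm v = sqrt (\<Sum>\<^sub>\<infinity>k. (norm (v k))\<^sup>2)"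

text \<open>
  For finitely supported filters and invertible \<open>M\<close>, the two infinite sums below have only
  finitely many nonzero terms.
\<close>

definition subdivision ::
  "(int^'d \<Rightarrow> complex^'q^'p) \<Rightarrow> int^'d^'d \<Rightarrow> (int^'d \<Rightarrow> complex^'p) \<Rightarrow> int^'d \<Rightarrow> complex^'q" where
  "subdivision a M u n =
    sqrt \<bar>real_of_int (det M)\<bar> *\<^sub>R (\<Sum>\<^sub>\<infinity>k. u k v* a (n - M *v k))"

definition transition ::
  "(int^'d \<Rightarrow> complex^'q^'p) \<Rightarrow> int^'d^'d \<Rightarrow> (int^'d \<Rightarrow> complex^'q) \<Rightarrow> int^'d \<Rightarrow> complex^'p" where
  "transition b M u n =
    sqrt \<bar>real_of_int (det M)\<bar> *\<^sub>R (\<Sum>\<^sub>\<infinity>k. u k v* conj_transpose (b (k - M *v n)))"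

text \<open>
  A tuple \<open>(w\<^bsub>1,1\<^esub>, \<dots>, w\<^bsub>s,J\<^esub>, w\<^bsub>0,J\<^esub>)\<close> of framelet coefficients is encoded as a pair: its
  first component maps \<open>l\<close> and \<open>j\<close> to \<open>w\<^bsub>l,j\<^esub>\<close>, where only the indices
  \<open>1 \<le> l \<le> s\<close> and \<open>1 \<le> j \<le> J\<close> matter, and its second component is \<open>w\<^bsub>0,J\<^esub>\<close>.
\<close>

type_synonym ('d, 'r) coeffs =
  "(nat \<Rightarrow> nat \<Rightarrow> int^'d \<Rightarrow> complex^1) \<times> (int^'d \<Rightarrow> complex^'r)"

definition coeffs_l2 :: "nat \<Rightarrow> nat \<Rightarrow> ('d::finite, 'r::finite) coeffs set" where
  "coeffs_l2 s J = {w. (\<forall>l\<in>{1..s}. \<forall>j\<in>{1..J}. fst w l j \<in> l2) \<and> snd w \<in> l2}"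

definition coeffs_norm :: "nat \<Rightarrow> nat \<Rightarrow> ('d::finite, 'r::finite) coeffs \<Rightarrow> real" where
  "coeffs_norm s J w =
    sqrt ((\<Sum>j=1..J. \<Sum>l=1..s. (l2_norm (fst w l j))\<^sup>2) + (l2_norm (snd w))\<^sup>2)"

primrec low_pass ::
  "(int^'d \<Rightarrow> complex^'r^'r) \<Rightarrow> int^'d^'d \<Rightarrow> (int^'d \<Rightarrow> complex^'r) \<Rightarrow> nat \<Rightarrow> int^'d \<Rightarrow> complex^'r"
where
  "low_pass b0 M0 v 0 = v"
| "low_pass b0 M0 v (Suc j) = transition b0 M0 (low_pass b0 M0 v j)"

definition analysis ::
  "nat \<Rightarrow> (nat \<Rightarrow> int^'d^'d) \<Rightarrow>
    (int^'d \<Rightarrow> complex^'r^'r) \<Rightarrow> (nat \<Rightarrow> int^'d \<Rightarrow> complex^'r^1) \<Rightarrow>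
    nat \<Rightarrow> (int^'d \<Rightarrow> complex^'r) \<Rightarrow> ('d::finite, 'r::finite) coeffs" where
  "analysis s M b0 b J v =
    (\<lambda>l j. if l \<in> {1..s} \<and> j \<in> {1..J}
           then transition (b l) (M l) (low_pass b0 (M 0) v (j - 1)) else (\<lambda>_. 0),
     low_pass b0 (M 0) v J)"

text \<open>
  One step of the recursion replaces \<open>w\<^bsub>0,j\<^esub>\<close> by \<open>w\<^bsub>0,j-1\<^esub>\<close>, so \<^term>\<open>synth_from\<close> with level
  \<open>j\<close> and sequence \<open>w\<^bsub>0,j\<^esub>\<close> yields \<open>w\<^bsub>0,0\<^esub>\<close>.
\<close>

primrec synth_from ::
  "nat \<Rightarrow> (nat \<Rightarrow> int^'d^'d) \<Rightarrow>
    (int^'d \<Rightarrow> complex^'r^'r) \<Rightarrow> (nat \<Rightarrow> int^'d \<Rightarrow> complex^'r^1) \<Rightarrow>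
    (nat \<Rightarrow> nat \<Rightarrow> int^'d \<Rightarrow> complex^1) \<Rightarrow> nat \<Rightarrow> (int^'d \<Rightarrow> complex^'r) \<Rightarrow> int^'d \<Rightarrow> complex^'r"
where
  "synth_from s M b0 b w 0 w0 = w0"
| "synth_from s M b0 b w (Suc j) w0 = synth_from s M b0 b w j
    (\<lambda>n. subdivision b0 (M 0) w0 n + (\<Sum>l=1..s. subdivision (b l) (M l) (w l (Suc j)) n))"

definition synthesis ::
  "nat \<Rightarrow> (nat \<Rightarrow> int^'d^'d) \<Rightarrow>
    (int^'d \<Rightarrow> complex^'r^'r) \<Rightarrow> (nat \<Rightarrow> int^'d \<Rightarrow> complex^'r^1) \<Rightarrow>
    nat \<Rightarrow> ('d::finite, 'r::finite) coeffs \<Rightarrow> int^'d \<Rightarrow> complex^'r" where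
  "synthesis s M b0 b J w = synth_from s M b0 b (fst w) J (snd w)"

definition operator_norm ::
  "'a set \<Rightarrow> ('a \<Rightarrow> real) \<Rightarrow> ('b \<Rightarrow> real) \<Rightarrow> ('a \<Rightarrow> 'b) \<Rightarrow> real" where
  "operator_norm A normA normB T = (SUP x\<in>{x\<in>A. normA x \<le> 1}. normB (T x))"

definition analysis_norm ::
  "nat \<Rightarrow> (nat \<Rightarrow> int^'d^'d) \<Rightarrow>
    (int^'d \<Rightarrow> complex^'r^'r) \<Rightarrow> (nat \<Rightarrow> int^'d \<Rightarrow> complex^'r^1) \<Rightarrow> nat \<Rightarrow> real" where
  "analysis_norm s M b0 b J =
    operator_norm l2 l2_norm (coeffs_norm s J) (analysis s M b0 b J)"

definition synthesis_norm ::
  "nat \<Rightarrow> (nat \<Rightarrow> int^'d^'d) \<Rightarrow>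
    (int^'d \<Rightarrow> complex^'r^'r) \<Rightarrow> (nat \<Rightarrow> int^'d \<Rightarrow> complex^'r^1) \<Rightarrow> nat \<Rightarrow> real" where
  "synthesis_norm s M b0 b J =
    operator_norm (coeffs_l2 s J) (coeffs_norm s J) l2_norm (synthesis s M b0 b J)"

definition l2_stability_bounds ::
  "nat \<Rightarrow> (nat \<Rightarrow> int^'d^'d) \<Rightarrow>
    (int^'d \<Rightarrow> complex^'r^'r) \<Rightarrow> (nat \<Rightarrow> int^'d \<Rightarrow> complex^'r^1) \<Rightarrow> real \<Rightarrow> real \<Rightarrow> bool" where
  "l2_stability_bounds s M b0 b c1 c2 \<longleftrightarrow>
    (\<forall>J\<ge>1. \<forall>v\<in>l2. c1 * (l2_norm v)\<^sup>2 \<le> (coeffs_norm s J (analysis s M b0 b J v))\<^sup>2 \<and>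
                     (coeffs_norm s J (analysis s M b0 b J v))\<^sup>2 \<le> c2 * (l2_norm v)\<^sup>2)"

definition l2_stable ::
  "nat \<Rightarrow> (nat \<Rightarrow> int^'d^'d) \<Rightarrow>
    (int^'d \<Rightarrow> complex^'r^'r) \<Rightarrow> (nat \<Rightarrow> int^'d \<Rightarrow> complex^'r^1) \<Rightarrow> bool" where
  "l2_stable s M b0 b \<longleftrightarrow> (\<exists>c1>0. \<exists>c2>0. l2_stability_bounds s M b0 b c1 c2)"

end

theory Submission
  imports Defs
begin

text \<open>
  Synthesis with a filter bank is the adjoint of analysis with it, so all the norm bounds (2)-(5)
  say the same thing. The time-domain form of the dual framelet condition is
  \<open>\<Sum>\<^sub>l |det M\<^sub>l| \<Sum>\<^sub>n b\<^sub>l(x - M\<^sub>l n)\<^sup>* b'\<^sub>l(y - M\<^sub>l n) = \<delta>(x - y) I\<close>, obtained by comparing the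
  coefficients of the trigonometric polynomials in \<open>\<xi>\<close>, multiplying by a character of \<open>\<omega>\<close> and
  summing over \<open>\<omega>\<close>; the weights appear because \<open>\<Omega> M\<close> has \<open>|det M|\<close> elements. It says that
  synthesis with \<open>b'\<close> inverts analysis with \<open>b\<close>. Hence
  \<open>\<parallel>v\<parallel>\<^sup>2 = \<langle>W' v, W v\<rangle> \<le> \<parallel>W' v\<parallel> \<parallel>W v\<parallel>\<close>, which turns the upper bound of one bank into the
  lower bound of the other.
\<close>

subsection \<open>Square-summable sequences\<close>

text \<open>The dilation matrices differ, so the dual condition at a frequency \<omega> involves
  only those \<open>l\<close> with \<omega> in \<open>\<Omega> (M l)\<close>. In terms of filter
  coefficients all \<open>l\<close> enter alike. Getting there takes three facts: a trigonometric
  polynomial that vanishes almost everywhere has zero coefficients; over the finite group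
  represented by \<open>\<Omega> M\<close> a character sums to zero or to the number of elements;
  and this number is \<open>\<bar>det M\<bar>\<close>. The last fact is proved by comparing volumes,
  hence the measure theory. On the coefficient side all sums at a fixed point are finite, so
  reconstruction is an identity for arbitrary sequences and the Fourier transform of an l2 sequence
  never appears. On complex vectors \<bullet> is the real inner product, so \<open>ip\<close> is the
  real part of the Hermitian pairing. It gives the same norm, and adjointness and Cauchy-Schwarz
  hold for it as well. The final inequality is symmetric in the two banks, so both lower bounds come
  from the one reconstruction.\<close>

definition ip :: "(int^'d \<Rightarrow> complex^'n) \<Rightarrow> (int^'d \<Rightarrow> complex^'n) \<Rightarrow> real" where
  "ip u v = (\<Sum>\<^sub>\<infinity>k. u k \<bullet> v k)"

lemma l2_norm_nonneg [simp]: "0 \<le> l2_norm u"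
  by (auto simp: l2_norm_def intro!: infsum_nonneg)

lemma l2_norm_power2: "(l2_norm u)\<^sup>2 = (\<Sum>\<^sub>\<infinity>k. (norm (u k))\<^sup>2)"
  by (auto simp: l2_norm_def intro!: infsum_nonneg)

lemma ip_self: "ip u u = (l2_norm u)\<^sup>2"
  by (simp add: ip_def l2_norm_power2 power2_norm_eq_inner)

lemma ip_commute: "ip u v = ip v u"
  by (simp add: ip_def inner_commute)

lemma l2I:
  assumes "\<And>F. finite F \<Longrightarrow> (\<Sum>k\<in>F. (norm (u k))\<^sup>2) \<le> B\<^sup>2"
  shows "u \<in> l2"
  unfolding l2_def mem_Collect_eq
  by (rule nonneg_bdd_above_summable_on) (auto intro!: bdd_aboveI2[where M = "B\<^sup>2"] assms)

lemma l2_norm_le: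
  assumes "u \<in> l2" "0 \<le> B" "\<And>F. finite F \<Longrightarrow> (\<Sum>k\<in>F. (norm (u k))\<^sup>2) \<le> B\<^sup>2"
  shows "l2_norm u \<le> B"
proof (rule power2_le_imp_le[OF _ assms(2)])
  show "(l2_norm u)\<^sup>2 \<le> B\<^sup>2"
    unfolding l2_norm_power2
    by (rule infsum_le_finite_sums) (use assms in \<open>auto simp: l2_def\<close>)
qed

lemma L2_set_le_l2_norm:
  assumes "u \<in> l2" "finite F"
  shows "L2_set (\<lambda>k. norm (u k)) F \<le> l2_norm u"
  unfolding L2_set_def l2_norm_def
  by (intro real_sqrt_le_mono finite_sum_le_infsum) (use assms in \<open>auto simp: l2_def\<close>)

text \<open>Minkowski's inequality on finite index sets. One bound on partial sums then yields both
  claims of \<open>l2_add\<close>.\<close>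

lemma l2_add_bound:
  assumes "u \<in> l2" "v \<in> l2" "finite F"
  shows "(\<Sum>k\<in>F. (norm (u k + v k))\<^sup>2) \<le> (l2_norm u + l2_norm v)\<^sup>2"
proof -
  have "L2_set (\<lambda>k. norm (u k + v k)) F \<le> L2_set (\<lambda>k. norm (u k) + norm (v k)) F"
    by (intro L2_set_mono norm_triangle_ineq) auto
  also have "\<dots> \<le> L2_set (\<lambda>k. norm (u k)) F + L2_set (\<lambda>k. norm (v k)) F"
    by (rule L2_set_triangle_ineq)
  also have "\<dots> \<le> l2_norm u + l2_norm v"
    by (intro add_mono L2_set_le_l2_norm assms)
  finally have "(L2_set (\<lambda>k. norm (u k + v k)) F)\<^sup>2 \<le> (l2_norm u + l2_norm v)\<^sup>2"
    by (intro power_mono) auto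
  thus ?thesis
    by (simp add: L2_set_def sum_nonneg)
qed

lemma l2_add:
  assumes "u \<in> l2" "v \<in> l2"
  shows "(\<lambda>k. u k + v k) \<in> l2" "l2_norm (\<lambda>k. u k + v k) \<le> l2_norm u + l2_norm v"
proof -
  show *: "(\<lambda>k. u k + v k) \<in> l2"
    using l2_add_bound[OF assms] by (rule l2I)
  show "l2_norm (\<lambda>k. u k + v k) \<le> l2_norm u + l2_norm v"
    using l2_add_bound[OF assms] by (intro l2_norm_le *) auto
qed

lemma l2_zero [simp]: "(\<lambda>_. 0) \<in> l2" "l2_norm (\<lambda>_. 0) = 0"
  by (simp_all add: l2_def l2_norm_def)

text \<open>Serves pointwise bounds (\<open>h\<close> the identity), sampling along a coset
  (\<open>h\<close> a shift of \<open>M\<close>) and upsampling (\<open>h\<close> its inverse).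
  Injectivity keeps values of \<open>u\<close> from being counted twice; it is asked only where
  \<open>v\<close> is nonzero because an upsampled sequence vanishes off its coset.\<close>

lemma l2_image:
  fixes u :: "int^'d \<Rightarrow> complex^'n" and v :: "int^'e \<Rightarrow> complex^'m"
  assumes u: "u \<in> l2" and "0 \<le> B" and inj: "inj_on h {n. v n \<noteq> 0}"
    and le: "\<And>n. v n \<noteq> 0 \<Longrightarrow> norm (v n) \<le> B * norm (u (h n))"
  shows "v \<in> l2" "l2_norm v \<le> B * l2_norm u"
proof -
  have bound: "(\<Sum>n\<in>F. (norm (v n))\<^sup>2) \<le> (B * l2_norm u)\<^sup>2" if F: "finite F" for F
  proof -
    let ?F = "{n\<in>F. v n \<noteq> 0}"
    have "(\<Sum>n\<in>F. (norm (v n))\<^sup>2) = (\<Sum>n\<in>?F. (norm (v n))\<^sup>2)"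
      by (rule sum.mono_neutral_right) (use F in auto)
    also have "\<dots> \<le> (\<Sum>n\<in>?F. (B * norm (u (h n)))\<^sup>2)"
      by (intro sum_mono power_mono le) auto
    also have "\<dots> = B\<^sup>2 * (\<Sum>n\<in>?F. (norm (u (h n)))\<^sup>2)"
      by (simp add: power_mult_distrib sum_distrib_left)
    also have "(\<Sum>n\<in>?F. (norm (u (h n)))\<^sup>2) = (\<Sum>k\<in>h ` ?F. (norm (u k))\<^sup>2)"
      by (rule sum.reindex_cong[symmetric, OF inj_on_subset[OF inj]]) auto
    also have "\<dots> \<le> (l2_norm u)\<^sup>2"
      unfolding l2_norm_power2
      by (rule finite_sum_le_infsum) (use u F in \<open>auto simp: l2_def\<close>)
    finally show ?thesis by (simp add: power_mult_distrib mult_left_mono)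
  qed
  show *: "v \<in> l2" using bound by (rule l2I)
  show "l2_norm v \<le> B * l2_norm u"
    using bound assms(2) by (intro l2_norm_le *) auto
qed

lemma l2_norm_scaleR [simp]: "l2_norm (\<lambda>k. c *\<^sub>R u k) = \<bar>c\<bar> * l2_norm u"
proof (rule power2_eq_imp_eq)
  show "(l2_norm (\<lambda>k. c *\<^sub>R u k))\<^sup>2 = (\<bar>c\<bar> * l2_norm u)\<^sup>2"
    by (simp add: power_mult_distrib l2_norm_power2 infsum_cmult_right')
qed auto

lemma l2_scaleR:
  assumes "u \<in> l2"
  shows "(\<lambda>k. c *\<^sub>R u k) \<in> l2"
  by (rule l2_image[OF assms, of "\<bar>c\<bar>" "\<lambda>k. k"]) auto

lemma l2_sum:
  assumes "\<And>i. i \<in> I \<Longrightarrow> u i \<in> l2"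
  shows "(\<lambda>k. \<Sum>i\<in>I. u i k) \<in> l2"
  using assms by (induction I rule: infinite_finite_induct) (auto intro!: l2_add)

lemma l2_inner_summable:
  assumes "u \<in> l2" "v \<in> l2"
  shows "(\<lambda>k. norm (u k \<bullet> v k)) summable_on UNIV"
proof (rule summable_on_comparison_test)
  show "(\<lambda>k. (norm (u k))\<^sup>2 + (norm (v k))\<^sup>2) summable_on UNIV"
    using assms by (intro summable_on_add) (auto simp: l2_def)
  fix k
  have "2 * (norm (u k) * norm (v k)) \<le> (norm (u k))\<^sup>2 + (norm (v k))\<^sup>2"
    using sum_squares_bound[of "norm (u k)" "norm (v k)"] by simp
  moreover have "0 \<le> norm (u k) * norm (v k)"
    by simp
  ultimately show *: "norm (u k \<bullet> v k) \<le> (norm (u k))\<^sup>2 + (norm (v k))\<^sup>2"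
    using Cauchy_Schwarz_ineq2[of "u k" "v k"] by (simp only: real_norm_def)
qed simp

lemma ip_Cauchy_Schwarz:
  assumes "u \<in> l2" "v \<in> l2"
  shows "ip u v \<le> l2_norm u * l2_norm v"
  unfolding ip_def
proof (rule infsum_le_finite_sums)
  show "(\<lambda>k. u k \<bullet> v k) summable_on UNIV"
    using l2_inner_summable[OF assms] by (rule abs_summable_summable)
  fix F :: "(int^'a) set" assume F: "finite F" "F \<subseteq> UNIV"
  have "(\<Sum>k\<in>F. u k \<bullet> v k) \<le> (\<Sum>k\<in>F. \<bar>norm (u k)\<bar> * \<bar>norm (v k)\<bar>)"
    by (intro sum_mono) (simp add: norm_cauchy_schwarz)
  also have "\<dots> \<le> L2_set (\<lambda>k. norm (u k)) F * L2_set (\<lambda>k. norm (v k)) F"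
    by (rule L2_set_mult_ineq)
  also have "\<dots> \<le> l2_norm u * l2_norm v"
    by (intro mult_mono L2_set_le_l2_norm) (use assms F in auto)
  finally show "(\<Sum>k\<in>F. u k \<bullet> v k) \<le> l2_norm u * l2_norm v" .
qed

lemma ip_add_right:
  assumes "u \<in> l2" "v \<in> l2" "w \<in> l2"
  shows "ip u (\<lambda>k. v k + w k) = ip u v + ip u w"
  unfolding ip_def inner_add_right
  by (intro infsum_add abs_summable_summable[OF l2_inner_summable] assms)

lemma ip_scaleR_right: "ip u (\<lambda>k. c *\<^sub>R v k) = c * ip u v"
  by (simp add: ip_def infsum_cmult_right')

lemma ip_sum_right:
  assumes "u \<in> l2" "\<And>i. i \<in> I \<Longrightarrow> v i \<in> l2"
  shows "ip u (\<lambda>k. \<Sum>i\<in>I. v i k) = (\<Sum>i\<in>I. ip u (v i))"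
  using assms(2)
proof (induction I rule: infinite_finite_induct)
  case (insert i I)
  thus ?case by (simp add: ip_add_right[OF assms(1)] l2_sum)
qed (auto simp: ip_def)

section \<open>Row vectors and matrices under the inner product\<close>

lemma inner_mult_complex: "(x * a) \<bullet> y = x \<bullet> (y * cnj a)" for a x y :: complex
  by (simp add: inner_complex_def algebra_simps)

text \<open>The source of the conjugate transpose in the transition operator.\<close>

lemma inner_vector_matrix_mult:
  fixes A :: "complex^'q^'p"
  shows "(x v* A) \<bullet> y = x \<bullet> (y v* conj_transpose A)"
proof -
  have "(x v* A) \<bullet> y = (\<Sum>j\<in>UNIV. \<Sum>i\<in>UNIV. (x $ i * A $ i $ j) \<bullet> y $ j)"
    by (simp add: inner_vec_def vector_matrix_mult_def inner_sum_left)
  also have "\<dots> = (\<Sum>i\<in>UNIV. \<Sum>j\<in>UNIV. (x $ i * A $ i $ j) \<bullet> y $ j)"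
    by (rule sum.swap)
  also have "\<dots> = x \<bullet> (y v* conj_transpose A)"
    by (simp add: inner_vec_def vector_matrix_mult_def conj_transpose_def inner_sum_right
        inner_mult_complex)
  finally show ?thesis .
qed

lemma vector_matrix_mult_zero_left [simp]: "0 v* A = 0"
  by (simp add: vector_matrix_mult_def vec_eq_iff)

lemma vector_matrix_mult_zero_right [simp]: "x v* 0 = 0"
  by (simp add: vector_matrix_mult_def vec_eq_iff)

lemma vector_matrix_mult_bound:
  fixes A :: "complex^'q^'p"
  shows "\<exists>B\<ge>0. \<forall>x. norm (x v* A) \<le> B * norm x"
proof -
  have "linear (\<lambda>x. x v* A)"
  proof (rule linearI)
    show "(x + y) v* A = x v* A + y v* A" for x y
      by (simp add: vector_matrix_mult_def vec_eq_iff distrib_right sum.distrib)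
    show "(c *\<^sub>R x) v* A = c *\<^sub>R (x v* A)" for c x
      by (simp add: vector_matrix_mult_def vec_eq_iff scaleR_sum_right)
  qed
  hence "bounded_linear (\<lambda>x. x v* A)" by (simp add: linear_conv_bounded_linear)
  from bounded_linear.nonneg_bounded[OF this] show ?thesis
    by (simp add: mult.commute)
qed

lemma conj_transpose_zero [simp]: "conj_transpose 0 = 0"
  by (simp add: conj_transpose_def vec_eq_iff)

subsection \<open>Subdivision and transition operators\<close>

text \<open>The substitution \<open>k = p + M *v n\<close> indexes the sum by the filter coefficient
  \<open>p\<close>. The operator becomes a finite combination of samplings of \<open>u\<close> along
  cosets, each followed by a fixed matrix.\<close>

lemma transition_eq:
  assumes "finite K" "{p. b p \<noteq> 0} \<subseteq> K"
  shows "transition b M u n = sqrt \<bar>real_of_int (det M)\<bar> *\<^sub>R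
    (\<Sum>p\<in>K. u (p + M *v n) v* conj_transpose (b p))"
proof -
  have "(\<Sum>\<^sub>\<infinity>k. u k v* conj_transpose (b (k - M *v n))) =
      (\<Sum>\<^sub>\<infinity>k\<in>(\<lambda>p. p + M *v n) ` K. u k v* conj_transpose (b (k - M *v n)))"
  proof (rule infsum_cong_neutral)
    fix k assume k: "k \<in> UNIV - (\<lambda>p. p + M *v n) ` K"
    have "k - M *v n \<notin> K"
    proof
      assume "k - M *v n \<in> K"
      hence "k - M *v n + M *v n \<in> (\<lambda>p. p + M *v n) ` K" by blast
      with k show False by simp
    qed
    hence "b (k - M *v n) = 0" using assms by blast
    thus "u k v* conj_transpose (b (k - M *v n)) = 0" by simp
  qed auto
  also have "\<dots> = (\<Sum>k\<in>(\<lambda>p. p + M *v n) ` K. u k v* conj_transpose (b (k - M *v n)))"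
    using assms by (intro infsum_finite) auto
  also have "\<dots> = (\<Sum>p\<in>K. u (p + M *v n) v* conj_transpose (b p))"
    by (subst sum.reindex) (auto simp: inj_on_def)
  finally show ?thesis by (simp add: transition_def)
qed

text \<open>Spreads \<open>u\<close> over the coset \<open>p + M *v k\<close> and is zero elsewhere.
  This is the adjoint of sampling along that coset, as \<open>ip_upsample\<close> shows.\<close>

definition upsample :: "int^'d^'d \<Rightarrow> int^'d \<Rightarrow> (int^'d \<Rightarrow> complex^'n) \<Rightarrow> int^'d \<Rightarrow> complex^'n" where
  "upsample M p u n = (if n \<in> range (\<lambda>k. p + M *v k) then u (inv (\<lambda>k. p + M *v k) n) else 0)"

lemma inj_shift: "inj (\<lambda>k. M *v k) \<Longrightarrow> inj (\<lambda>k. p + M *v k)" for M :: "int^'d^'d"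
  by (auto simp: inj_def)

text \<open>The counterpart of \<open>transition_eq\<close> with the same index \<open>p\<close>, so
  that adjointness can be checked coefficient by coefficient. An index \<open>k\<close> contributes
  to \<open>p = n - M *v k\<close> alone, and a \<open>p\<close> not of this form contributes zero
  since \<open>n\<close> lies off its coset.\<close>

lemma subdivision_eq:
  assumes M: "inj (\<lambda>k. M *v k)" and "finite K" "{p. b p \<noteq> 0} \<subseteq> K"
  shows "subdivision b M u n = sqrt \<bar>real_of_int (det M)\<bar> *\<^sub>R
    (\<Sum>p\<in>K. upsample M p (\<lambda>k. u k v* b p) n)"
proof -
  let ?h = "\<lambda>k. n - M *v k"
  have inj: "inj ?h" using M by (auto simp: inj_def)
  have "(\<Sum>\<^sub>\<infinity>k. u k v* b (?h k)) = (\<Sum>\<^sub>\<infinity>k\<in>?h -` K. u k v* b (?h k))"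
  proof (rule infsum_cong_neutral)
    fix k assume "k \<in> UNIV - ?h -` K"
    hence "b (?h k) = 0" using assms by blast
    thus "u k v* b (?h k) = 0" by simp
  qed auto
  also have "\<dots> = (\<Sum>k\<in>?h -` K. u k v* b (?h k))"
    by (intro infsum_finite finite_vimageI assms inj)
  also have "\<dots> = (\<Sum>k\<in>?h -` K. upsample M (?h k) (\<lambda>k'. u k' v* b (?h k)) n)"
  proof (rule sum.cong[OF refl])
    fix k
    have eq: "?h k + M *v k = n" by simp
    have "inv (\<lambda>k'. ?h k + M *v k') n = k"
      using inv_f_f[OF inj_shift[OF M, of "?h k"], of k] unfolding eq .
    moreover have "n \<in> range (\<lambda>k'. ?h k + M *v k')"
      by (rule range_eqI[of _ _ k]) simp
    ultimately show "u k v* b (?h k) = upsample M (?h k) (\<lambda>k'. u k' v* b (?h k)) n"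
      by (simp add: upsample_def)
  qed
  also have "\<dots> = (\<Sum>p\<in>?h ` (?h -` K). upsample M p (\<lambda>k'. u k' v* b p) n)"
    by (rule sum.reindex[OF inj_on_subset[OF inj], unfolded comp_def, symmetric]) auto
  also have "\<dots> = (\<Sum>p\<in>K. upsample M p (\<lambda>k'. u k' v* b p) n)"
  proof (rule sum.mono_neutral_left)
    show "\<forall>p\<in>K - ?h ` (?h -` K). upsample M p (\<lambda>k'. u k' v* b p) n = 0"
      by (auto simp: upsample_def image_iff algebra_simps)
  qed (use assms in auto)
  finally show ?thesis by (simp add: subdivision_def)
qed

lemma vector_matrix_mult_l2:
  assumes "u \<in> l2"
  shows "(\<lambda>k. u k v* A) \<in> l2"
proof -
  obtain B where B: "0 \<le> B" "\<And>x. norm (x v* A) \<le> B * norm x"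
    using vector_matrix_mult_bound[of A] by auto
  show ?thesis
    by (rule l2_image(1)[OF assms B(1), of "\<lambda>k. k"]) (simp_all add: B(2))
qed

lemma upsample_l2:
  assumes M: "inj (\<lambda>k. M *v k)" and u: "u \<in> l2"
  shows "upsample M p u \<in> l2"
proof (rule l2_image(1)[OF u, of 1 "inv (\<lambda>k. p + M *v k)"])
  have "{n. upsample M p u n \<noteq> 0} \<subseteq> range (\<lambda>k. p + M *v k)"
    by (auto simp: upsample_def)
  thus "inj_on (inv (\<lambda>k. p + M *v k)) {n. upsample M p u n \<noteq> 0}"
    using inj_on_inv_into by blast
qed (auto simp: upsample_def)

lemma ip_upsample:
  assumes M: "inj (\<lambda>k. M *v k)"
  shows "ip v (upsample M p u) = (\<Sum>\<^sub>\<infinity>k. v (p + M *v k) \<bullet> u k)"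
proof -
  let ?h = "\<lambda>k. p + M *v k"
  have "ip v (upsample M p u) = (\<Sum>\<^sub>\<infinity>n\<in>range ?h. v n \<bullet> upsample M p u n)"
    unfolding ip_def by (rule infsum_cong_neutral) (auto simp: upsample_def)
  also have "\<dots> = (\<Sum>\<^sub>\<infinity>k. v (?h k) \<bullet> upsample M p u (?h k))"
    by (subst infsum_reindex[OF inj_shift[OF M]]) (simp add: comp_def)
  also have "\<dots> = (\<Sum>\<^sub>\<infinity>k. v (?h k) \<bullet> u k)"
    by (simp add: upsample_def inv_f_f[OF inj_shift[OF M]])
  finally show ?thesis .
qed

lemma l2_transition_term:
  fixes M :: "int^'d^'d"
  assumes M: "inj (\<lambda>k. M *v k)" and u: "u \<in> l2" and B: "0 \<le> B" "\<And>x. norm (x v* A) \<le> B * norm x"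
  shows "(\<lambda>n. u (p + M *v n) v* A) \<in> l2"
        "l2_norm (\<lambda>n. u (p + M *v n) v* A) \<le> B * l2_norm u"
  by (rule l2_image[OF u B(1) inj_on_subset[OF inj_shift[OF M, of p] subset_UNIV] B(2)])+

text \<open>Sampling does not increase the norm and a fixed matrix acts boundedly, so the constants
  of the finitely many filter coefficients add up.\<close>

lemma transition_bounded:
  assumes M: "inj (\<lambda>k. M *v k)" and b: "fin_supp b"
  shows "\<exists>B\<ge>0. \<forall>u\<in>l2. transition b M u \<in> l2 \<and> l2_norm (transition b M u) \<le> B * l2_norm u"
proof -
  let ?t = "\<lambda>u p n. u (p + M *v n) v* conj_transpose (b p)"
  \<comment> \<open>Membership and bound go through the induction together, because the triangle
    inequality \<open>l2_add\<close> asks for membership of both summands.\<close>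
  have step: "\<exists>B\<ge>0. \<forall>u\<in>l2. (\<lambda>n. \<Sum>p\<in>K. ?t u p n) \<in> l2 \<and> 
      l2_norm (\<lambda>n. \<Sum>p\<in>K. ?t u p n) \<le> B * l2_norm u" if "finite K" for K
    using that
  proof induction
    case empty thus ?case by (intro exI[of _ 0]) auto
  next
    case (insert p K)
    then obtain B1 where B1: "B1 \<ge> 0" "\<And>u. u \<in> l2 \<Longrightarrow> (\<lambda>n. \<Sum>p\<in>K. ?t u p n) \<in> l2"
      "\<And>u. u \<in> l2 \<Longrightarrow> l2_norm (\<lambda>n. \<Sum>p\<in>K. ?t u p n) \<le> B1 * l2_norm u" by auto
    obtain B2 where B2: "0 \<le> B2" "\<And>x. norm (x v* conj_transpose (b p)) \<le> B2 * norm x"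
      using vector_matrix_mult_bound[of "conj_transpose (b p)"] by auto
    show ?case
    proof (intro exI[of _ "B2 + B1"] conjI ballI)
      fix u :: "int^'a \<Rightarrow> complex^'b" assume u: "u \<in> l2"
      note t = l2_transition_term[OF M u B2, of p]
      show "(\<lambda>n. \<Sum>p\<in>insert p K. ?t u p n) \<in> l2"
        using insert l2_add(1)[OF t(1) B1(2)[OF u]] by simp
      show "l2_norm (\<lambda>n. \<Sum>p\<in>insert p K. ?t u p n) \<le> (B2 + B1) * l2_norm u"
        using insert l2_add(2)[OF t(1) B1(2)[OF u]] t(2) B1(3)[OF u] by (simp add: algebra_simps)
    qed (use B1(1) B2(1) in auto)
  qed
  have fin: "finite {p. b p \<noteq> 0}" using b by (simp add: fin_supp_def)
  obtain B where B: "B \<ge> 0" "\<And>u. u \<in> l2 \<Longrightarrow> (\<lambda>n. \<Sum>p | b p \<noteq> 0. ?t u p n) \<in> l2"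
      "\<And>u. u \<in> l2 \<Longrightarrow> l2_norm (\<lambda>n. \<Sum>p | b p \<noteq> 0. ?t u p n) \<le> B * l2_norm u"
    using step[OF fin] by auto
  let ?c = "sqrt \<bar>real_of_int (det M)\<bar>"
  have eq: "transition b M u = (\<lambda>n. ?c *\<^sub>R (\<Sum>p | b p \<noteq> 0. ?t u p n))" for u
    by (rule ext) (rule transition_eq[OF fin order.refl])
  show ?thesis
  proof (intro exI[of _ "?c * B"] conjI ballI)
    fix u :: "int^'a \<Rightarrow> complex^'b" assume u: "u \<in> l2"
    show "transition b M u \<in> l2"
      unfolding eq by (rule l2_scaleR[OF B(2)[OF u]])
    have "l2_norm (transition b M u) = ?c * l2_norm (\<lambda>n. \<Sum>p | b p \<noteq> 0. ?t u p n)"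
      unfolding eq by simp
    also have "\<dots> \<le> ?c * (B * l2_norm u)"
      by (rule mult_left_mono[OF B(3)[OF u]]) simp
    finally show "l2_norm (transition b M u) \<le> ?c * B * l2_norm u" by (simp add: mult.assoc)
  qed (use B(1) in auto)
qed

lemma transition_l2:
  assumes "inj (\<lambda>k. M *v k)" "fin_supp b" "u \<in> l2"
  shows "transition b M u \<in> l2"
  using transition_bounded[OF assms(1,2)] assms(3) by auto

lemma subdivision_l2:
  assumes M: "inj (\<lambda>k. M *v k)" and b: "fin_supp b" and u: "u \<in> l2"
  shows "subdivision b M u \<in> l2"
proof -
  have fin: "finite {p. b p \<noteq> 0}" using b by (simp add: fin_supp_def)
  have eq: "subdivision b M u = (\<lambda>n. sqrt \<bar>real_of_int (det M)\<bar> *\<^sub>R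
      (\<Sum>p | b p \<noteq> 0. upsample M p (\<lambda>k. u k v* b p) n))"
    by (rule ext) (rule subdivision_eq[OF M fin order.refl])
  show ?thesis
    unfolding eq by (intro l2_scaleR l2_sum upsample_l2 M vector_matrix_mult_l2 u)
qed

text \<open>Both operators are the same multiple of a sum over the support of \<open>b\<close>. For
  each \<open>p\<close>, upsampling is adjoint to sampling and \<open>b p\<close> to its conjugate
  transpose.\<close>

lemma ip_subdivision:
  assumes M: "inj (\<lambda>k. M *v k)" and b: "fin_supp b" and u: "u \<in> l2" and v: "v \<in> l2"
  shows "ip v (subdivision b M u) = ip (transition b M v) u"
proof -
  have fin: "finite {p. b p \<noteq> 0}" using b by (simp add: fin_supp_def)
  let ?c = "sqrt \<bar>real_of_int (det M)\<bar>"
  let ?t = "\<lambda>p n. v (p + M *v n) v* conj_transpose (b p)"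
  have eq: "subdivision b M u = (\<lambda>n. ?c *\<^sub>R
      (\<Sum>p | b p \<noteq> 0. upsample M p (\<lambda>k. u k v* b p) n))"
    by (rule ext) (rule subdivision_eq[OF M fin order.refl])
  have eq': "transition b M v = (\<lambda>n. ?c *\<^sub>R (\<Sum>p | b p \<noteq> 0. ?t p n))"
    by (rule ext) (rule transition_eq[OF fin order.refl])
  have t: "?t p \<in> l2" for p
  proof -
    obtain B where "0 \<le> B" "\<And>x. norm (x v* conj_transpose (b p)) \<le> B * norm x"
      using vector_matrix_mult_bound[of "conj_transpose (b p)"] by auto
    thus ?thesis by (rule l2_transition_term(1)[OF M v])
  qed
  have U: "upsample M p (\<lambda>k. u k v* b p) \<in> l2" for p
    by (rule upsample_l2[OF M vector_matrix_mult_l2[OF u]])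
  have swap: "ip v (upsample M p (\<lambda>k. u k v* b p)) = ip u (?t p)" for p
    unfolding ip_upsample[OF M] unfolding ip_def
  proof (rule infsum_cong)
    fix k
    show "v (p + M *v k) \<bullet> (u k v* b p) = u k \<bullet> (v (p + M *v k) v* conj_transpose (b p))"
      by (subst inner_commute) (rule inner_vector_matrix_mult)
  qed
  have "ip v (subdivision b M u) = ?c * (\<Sum>p | b p \<noteq> 0. ip v (upsample M p (\<lambda>k. u k v* b p)))"
    unfolding eq ip_scaleR_right ip_sum_right[OF v U] ..
  also have "\<dots> = ip u (transition b M v)"
    unfolding eq' ip_scaleR_right ip_sum_right[OF u t] swap ..
  finally show ?thesis by (simp only: ip_commute)
qed

section \<open>Integer vectors inside real space and dilation matrices\<close>

lemma int_to_real_vec_nth [simp]: "int_to_real_vec k $ i = real_of_int (k $ i)"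
  by (simp add: int_to_real_vec_def)

lemma int_to_real_vec_add: "int_to_real_vec (k + m) = int_to_real_vec k + int_to_real_vec m"
  by (simp add: vec_eq_iff)

lemma int_to_real_vec_minus: "int_to_real_vec (- k) = - int_to_real_vec k"
  by (simp add: vec_eq_iff)

lemma int_to_real_vec_diff: "int_to_real_vec (k - m) = int_to_real_vec k - int_to_real_vec m"
  by (simp add: vec_eq_iff)

lemma int_to_real_vec_0 [simp]: "int_to_real_vec 0 = 0"
  by (simp add: vec_eq_iff)

lemma int_to_real_vec_eq_iff [simp]: "int_to_real_vec k = int_to_real_vec m \<longleftrightarrow> k = m"
  by (simp add: vec_eq_iff)

lemma int_to_real_vec_mult:
  "int_to_real_vec (M *v k) = map_matrix real_of_int M *v int_to_real_vec k"
  by (simp add: vec_eq_iff matrix_vector_mult_def)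

lemma int_to_real_vec_inner_Ints: "int_to_real_vec k \<bullet> int_to_real_vec m \<in> \<int>"
  unfolding inner_vec_def by (rule Ints_sum) (simp flip: of_int_mult)

lemma det_map_matrix_of_int: "det (map_matrix of_int M) = (of_int (det M) :: 'a :: comm_ring_1)"
  by (simp add: det_def)

lemma transpose_map_matrix: "transpose (map_matrix f M) = map_matrix f (transpose M)"
  by (simp add: transpose_def vec_eq_iff)

text \<open>A nonzero kernel vector would be an eigenvector for the eigenvalue 0, whose modulus is
  not greater than 1. The dilation hypothesis enters the proof here.\<close>

lemma dilation_matrix_det_nz:
  assumes "dilation_matrix M"
  shows "det M \<noteq> 0"
proof -
  let ?N = "map_matrix of_int M :: complex^'a^'a"
  have "x = 0" if "?N *v x = 0" for x
  proof (rule ccontr)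
    assume "x \<noteq> 0"
    moreover have "?N *v x = 0 *s x" using that by simp
    ultimately have "cmod 0 > 1"
      using assms[unfolded dilation_matrix_def, rule_format, of x 0] by simp
    thus False by simp
  qed
  hence "\<exists>B. B ** ?N = mat 1"
    by (simp add: matrix_left_invertible_ker)
  hence "invertible ?N"
    by (simp add: invertible_left_inverse)
  hence "det ?N \<noteq> 0"
    by (simp add: invertible_det_nz)
  thus ?thesis by (simp add: det_map_matrix_of_int)
qed

lemma inj_int_matrix:
  fixes M :: "int^'d^'d"
  assumes "det M \<noteq> 0"
  shows "inj (\<lambda>k. M *v k)"
proof (rule injI)
  fix k m :: "int^'d"
  assume eq: "M *v k = M *v m"
  have "det (map_matrix real_of_int M) \<noteq> 0"
    using assms by (simp add: det_map_matrix_of_int)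
  hence "inj ((*v) (map_matrix real_of_int M))"
    by (simp add: inj_matrix_vector_mult invertible_det_nz)
  moreover have "map_matrix real_of_int M *v int_to_real_vec k = map_matrix real_of_int M *v int_to_real_vec m"
    using eq by (simp flip: int_to_real_vec_mult)
  ultimately have "int_to_real_vec k = int_to_real_vec m" by (rule injD)
  thus "k = m" by simp
qed

subsection \<open>Counting \<open>\<Omega> M\<close>\<close>

lemma emeasure_lborel_translate:
  fixes A :: "'a::euclidean_space set"
  assumes "A \<in> sets borel"
  shows "emeasure lborel {x. c + x \<in> A} = emeasure lborel A"
proof -
  have "emeasure lborel A = emeasure (distr lborel borel ((+) c)) A"
    by (simp add: lborel_distr_plus)
  also have "\<dots> = emeasure lborel ((+) c -` A \<inter> space lborel)"
    using assms by (intro emeasure_distr) auto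
  also have "(+) c -` A \<inter> space lborel = {x. c + x \<in> A}" by auto
  finally show ?thesis by simp
qed

lemma emeasure_decompose_translates:
  fixes L P P' :: "'a::euclidean_space set"
  assumes L: "countable L" and P [measurable]: "P \<in> sets borel" "P' \<in> sets borel"
    and ex: "\<And>x. \<exists>!l. l \<in> L \<and> x - l \<in> P'"
  shows "emeasure lborel P = (\<integral>\<^sup>+l. emeasure lborel {x\<in>P. x - l \<in> P'} \<partial>count_space L)"
proof -
  have "P = (\<Union>l\<in>L. {x\<in>P. x - l \<in> P'})" using ex by blast
  also have "emeasure lborel \<dots> = (\<integral>\<^sup>+l. emeasure lborel {x\<in>P. x - l \<in> P'} \<partial>count_space L)"
  proof (rule emeasure_UN_countable)
    show "disjoint_family_on (\<lambda>l. {x \<in> P. x - l \<in> P'}) L"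
      using ex unfolding disjoint_family_on_def by blast
    fix l
    have "{x \<in> P. x - l \<in> P'} = P \<inter> ((\<lambda>x. x - l) -` P' \<inter> space borel)" by auto
    also have "\<dots> \<in> sets borel" by measurable
    finally show "{x \<in> P. x - l \<in> P'} \<in> sets lborel" by simp
  qed (use L in auto)
  finally show ?thesis .
qed

text \<open>Two fundamental domains of one lattice have equal volume: cut each by the translates of
  the other. Moving the piece of \<open>P\<close> lying in \<open>l + P'\<close> back by
  \<open>l\<close> gives the piece of \<open>P'\<close> lying in \<open>- l + P\<close>, so the two
  families of pieces match under negation of \<open>l\<close>.\<close>

lemma emeasure_fundamental_domains:
  fixes L P P' :: "'a::euclidean_space set"
  assumes L: "countable L" "\<And>l. l \<in> L \<Longrightarrow> - l \<in> L"
    and P [measurable]: "P \<in> sets borel" "P' \<in> sets borel"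
    and ex: "\<And>x. \<exists>!l. l \<in> L \<and> x - l \<in> P" "\<And>x. \<exists>!l. l \<in> L \<and> x - l \<in> P'"
  shows "emeasure lborel P = emeasure lborel P'"
proof -
  have "emeasure lborel P = (\<integral>\<^sup>+l. emeasure lborel {x\<in>P. x - l \<in> P'} \<partial>count_space L)"
    by (rule emeasure_decompose_translates[OF L(1) P ex(2)])
  also have "\<dots> = (\<integral>\<^sup>+l. emeasure lborel {x\<in>P'. x - (- l) \<in> P} \<partial>count_space L)"
  proof (rule nn_integral_cong)
    fix l
    have "{x \<in> P. x - l \<in> P'} = P \<inter> ((\<lambda>x. x - l) -` P' \<inter> space borel)" by auto
    also have "\<dots> \<in> sets borel" by measurable
    finally have "emeasure lborel {x \<in> P. x - l \<in> P'} = emeasure lborel {x. l + x \<in> {x \<in> P. x - l \<in> P'}}"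
      by (rule emeasure_lborel_translate[symmetric])
    also have "{x. l + x \<in> {x \<in> P. x - l \<in> P'}} = {x\<in>P'. x - (- l) \<in> P}"
      by (auto simp: add.commute)
    finally show "emeasure lborel {x \<in> P. x - l \<in> P'} = emeasure lborel {x\<in>P'. x - (- l) \<in> P}" .
  qed
  also have "\<dots> = (\<integral>\<^sup>+l. emeasure lborel {x\<in>P'. x - l \<in> P} \<partial>count_space L)"
  proof (rule nn_integral_bij_count_space)
    show "bij_betw uminus L L"
      by (rule bij_betw_byWitness[of _ uminus]) (use L(2) in auto)
  qed
  also have "\<dots> = emeasure lborel P'"
    by (rule emeasure_decompose_translates[OF L(1) P(2,1) ex(1), symmetric])
  finally show ?thesis .
qed

definition unit_cube :: "(real^'d) set" where
  "unit_cube = {x. \<forall>i. 0 \<le> x $ i \<and> x $ i < 1}"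

definition vfloor :: "real^'d \<Rightarrow> int^'d" where
  "vfloor x = (\<chi> i. \<lfloor>x $ i\<rfloor>)"

text \<open>The half-open cube is a fundamental domain of the integer lattice, with
  \<open>vfloor\<close> selecting the translate. All uniqueness arguments for translates below rest
  on this.\<close>

lemma diff_in_unit_cube_iff: "x - int_to_real_vec k \<in> unit_cube \<longleftrightarrow> k = vfloor x"
proof -
  have "0 \<le> x $ i - real_of_int (k $ i) \<and> x $ i - real_of_int (k $ i) < 1 \<longleftrightarrow> k $ i = \<lfloor>x $ i\<rfloor>" for i
    by linarith
  thus ?thesis by (simp add: unit_cube_def vfloor_def vec_eq_iff)
qed

lemma unit_cube_borel [measurable]: "unit_cube \<in> sets borel"
proof -
  have "unit_cube = (\<Inter>i. {x::real^'d. 0 \<le> x $ i} \<inter> {x. x $ i < 1})"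
    by (auto simp: unit_cube_def)
  also have "\<dots> \<in> sets borel"
    by (intro sets.finite_INT sets.Int borel_closed borel_open closed_Collect_le open_Collect_less
        continuous_intros) auto
  finally show ?thesis .
qed

text \<open>The half-open cube lies between the open and the closed unit box, both of volume
  1.\<close>

lemma emeasure_unit_cube: "emeasure lborel (unit_cube :: (real^'d) set) = 1"
proof (rule antisym)
  have inner_Basis: "(1 :: real^'d) \<bullet> b = 1" if "b \<in> Basis" for b
    using that by (auto simp: Basis_vec_def inner_axis)
  have "unit_cube \<subseteq> cbox 0 (1::real^'d)"
    by (auto simp: unit_cube_def mem_box_cart less_imp_le)
  hence "emeasure lborel (unit_cube :: (real^'d) set) \<le> emeasure lborel (cbox 0 (1::real^'d))"
    by (rule emeasure_mono) simp
  also have "\<dots> = 1" by (simp add: inner_Basis)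
  finally show "emeasure lborel (unit_cube :: (real^'d) set) \<le> 1" .
  have "1 = emeasure lborel (box 0 (1::real^'d))" by (simp add: inner_Basis)
  also have "\<dots> \<le> emeasure lborel (unit_cube :: (real^'d) set)"
    by (rule emeasure_mono) (auto simp: unit_cube_def mem_box_cart less_imp_le)
  finally show "1 \<le> emeasure lborel (unit_cube :: (real^'d) set)" .
qed

lemma matrix_inv_mult:
  fixes A :: "real^'d^'d"
  assumes "det A \<noteq> 0"
  shows "matrix_inv A *v (A *v x) = x" "A *v (matrix_inv A *v x) = x"
proof -
  have "\<exists>B. A ** B = mat 1 \<and> B ** A = mat 1"
    using assms by (simp add: invertible_det_nz[symmetric] invertible_def)
  hence "A ** matrix_inv A = mat 1 \<and> matrix_inv A ** A = mat 1"
    unfolding matrix_inv_def by (rule someI_ex)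
  thus "matrix_inv A *v (A *v x) = x" "A *v (matrix_inv A *v x) = x"
    by (simp_all add: matrix_vector_mul_assoc)
qed

section \<open>Lebesgue measure under linear maps\<close>

lemma measure_shear_cbox:
  fixes a b :: "real^'n"
  assumes "m \<noteq> n"
  defines "f \<equiv> \<lambda>x::real^'n. \<chi> i. if i = m then x $ m + x $ n else x $ i"
  shows "measure lebesgue (f ` cbox a b) = measure lebesgue (cbox a b)"
proof (cases "cbox a b = {}")
  case False
  have add: "f (x + y) = f x + f y" for x y
    by (simp add: f_def vec_eq_iff)
  \<comment> \<open>Moving the lower corner to the origin makes its coordinates nonnegative, as
    \<open>measure_shear_interval\<close> wants. By additivity of \<open>f\<close> the image moves
    by \<open>f a\<close>, which leaves its measure unchanged.\<close>
  have ab: "cbox a b = (+) a ` cbox 0 (b - a)"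
    using cbox_translation[of a 0 "b - a"] by simp
  have "f ` cbox a b = (+) (f a) ` f ` cbox 0 (b - a)"
    unfolding ab by (simp add: image_image add)
  hence "measure lebesgue (f ` cbox a b) = measure lebesgue (f ` cbox 0 (b - a))"
    by (simp add: measure_translation)
  also have "\<dots> = measure lebesgue (cbox 0 (b - a))"
    unfolding f_def using False ab assms(1) by (intro measure_shear_interval) auto
  also have "\<dots> = measure lebesgue (cbox a b)"
    unfolding ab by (simp only: measure_translation)
  finally show ?thesis .
qed simp

text \<open>The coordinate swap is an involution that carries boxes to boxes and only permutes the
  side lengths.\<close>

lemma measure_swap_cbox:
  fixes a b :: "real^'n" and m n :: 'n
  defines "f \<equiv> \<lambda>x::real^'n. \<chi> i. x $ Transposition.transpose m n i"
  shows "measure lebesgue (f ` cbox a b) = measure lebesgue (cbox a b)"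
proof (cases "cbox a b = {}")
  case False
  have ff: "f (f x) = x" for x by (simp add: f_def vec_eq_iff)
  have mem: "f x \<in> cbox (f a) (f b)" if "x \<in> cbox a b" for x a b
    using that by (simp add: f_def mem_box_cart)
  have eq: "f ` cbox a b = cbox (f a) (f b)"
  proof
    show "cbox (f a) (f b) \<subseteq> f ` cbox a b"
    proof
      fix x assume "x \<in> cbox (f a) (f b)"
      hence "f x \<in> cbox a b" using mem[of x "f a" "f b"] by (simp add: ff)
      thus "x \<in> f ` cbox a b" by (rule image_eqI[rotated]) (simp add: ff)
    qed
  qed (use mem in auto)
  moreover have "cbox (f a) (f b) \<noteq> {}" using False eq by blast
  moreover have "(\<Prod>i\<in>UNIV. f b $ i - f a $ i) = (\<Prod>i\<in>UNIV. b $ i - a $ i)"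
    by (rule prod.reindex_bij_witness[of _ "Transposition.transpose m n" "Transposition.transpose m n"])
      (auto simp: f_def)
  ultimately show ?thesis using False by (simp add: content_cbox_cart)
qed simp

text \<open>
  The library has this only for index types of class \<^class>\<open>wellorder\<close>.
\<close>

lemma measure_matrix_image:
  fixes A :: "real^'n^'n"
  assumes "det A \<noteq> 0" and "S \<in> lmeasurable"
  shows "(*v) A ` S \<in> lmeasurable" "measure lebesgue ((*v) A ` S) = \<bar>det A\<bar> * measure lebesgue S"
proof -
  \<comment> \<open>The guard on the determinant makes the zero-row case of the induction on
    elementary matrices vacuous. It survives products, since a nonzero determinant of
    \<open>A ** B\<close> gives nonzero determinants of both factors.\<close>
  define P where "P A \<longleftrightarrow> (det A \<noteq> 0 \<longrightarrow> (\<forall>S\<in>lmeasurable. (*v) A ` S \<in> lmeasurable \<and>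
      measure lebesgue ((*v) A ` S) = \<bar>det A\<bar> * measure lebesgue S))" for A :: "real^'n^'n"
  \<comment> \<open>For swaps and shears it suffices that volumes of boxes are preserved;
    \<open>measure_linear_sufficient\<close> passes from boxes to all measurable sets.\<close>
  have unit: "P A" if det: "\<bar>det A\<bar> = 1" and
    box: "\<And>a b. measure lebesgue ((*v) A ` cbox a b) = measure lebesgue (cbox a b)"
    for A :: "real^'n^'n"
    unfolding P_def
  proof (intro impI ballI)
    fix S :: "(real^'n) set" assume S: "S \<in> lmeasurable"
    show "(*v) A ` S \<in> lmeasurable \<and> measure lebesgue ((*v) A ` S) = \<bar>det A\<bar> * measure lebesgue S"
      using measure_linear_sufficient[OF matrix_vector_mul_linear S, of A 1] box det by simp
  qed
  have "P A"
  proof (rule induct_matrix_elementary_alt)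
    fix A B :: "real^'n^'n" assume AB: "P A" "P B"
    show "P (A ** B)"
      unfolding P_def
    proof (intro impI ballI)
      fix S :: "(real^'n) set" assume det: "det (A ** B) \<noteq> 0" and S: "S \<in> lmeasurable"
      have nz: "det A \<noteq> 0" "det B \<noteq> 0" using det by (auto simp: det_mul)
      have B: "(*v) B ` S \<in> lmeasurable" "measure lebesgue ((*v) B ` S) = \<bar>det B\<bar> * measure lebesgue S"
        using AB(2) nz S by (auto simp: P_def)
      have "(*v) A ` (*v) B ` S \<in> lmeasurable"
        "measure lebesgue ((*v) A ` (*v) B ` S) = \<bar>det A\<bar> * measure lebesgue ((*v) B ` S)"
        using AB(1) nz B(1) by (auto simp: P_def)
      moreover have "(*v) A ` (*v) B ` S = (*v) (A ** B) ` S"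
        by (simp add: image_image matrix_vector_mul_assoc)
      ultimately show "(*v) (A ** B) ` S \<in> lmeasurable \<and>
          measure lebesgue ((*v) (A ** B) ` S) = \<bar>det (A ** B)\<bar> * measure lebesgue S"
        using B(2) by (simp add: det_mul abs_mult)
    qed
  next
    fix A :: "real^'n^'n" and i assume "row i A = 0"
    thus "P A" by (simp add: P_def det_zero_row)
  next
    fix A :: "real^'n^'n" assume diag: "\<And>i j. i \<noteq> j \<Longrightarrow> A $ i $ j = 0"
    have "A *v x = (\<chi> i. A $ i $ i * x $ i)" for x
    proof -
      have "(\<Sum>j\<in>UNIV. A $ i $ j * x $ j) = (\<Sum>j\<in>{i}. A $ i $ j * x $ j)" for i
        by (rule sum.mono_neutral_right) (use diag in auto)
      thus ?thesis by (simp add: matrix_vector_mult_def)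
    qed
    hence eq: "(*v) A = (\<lambda>x. \<chi> i. A $ i $ i * x $ i)" by blast
    have det: "det A = (\<Prod>i\<in>UNIV. A $ i $ i)" using diag by (rule det_diagonal)
    show "P A"
      unfolding P_def eq det
    proof (intro impI ballI conjI)
      fix S :: "(real^'n) set" assume S: "S \<in> lmeasurable"
      show "(\<lambda>x. \<chi> i. A $ i $ i * x $ i) ` S \<in> lmeasurable"
        by (rule measurable_stretch[OF S])
      show "measure lebesgue ((\<lambda>x. \<chi> i. A $ i $ i * x $ i) ` S) =
          \<bar>\<Prod>i\<in>UNIV. A $ i $ i\<bar> * measure lebesgue S"
        by (rule measure_stretch[OF S])
    qed
  next
    fix m n :: 'n
    let ?B = "\<chi> i j. mat 1 $ i $ Transposition.transpose m n j :: real^'n^'n"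
    have "?B *v x = (\<chi> i. x $ Transposition.transpose m n i)" for x :: "real^'n"
    proof -
      have "(\<Sum>j\<in>UNIV. (if i = Transposition.transpose m n j then 1 else 0) * x $ j) =
          (\<Sum>j\<in>{Transposition.transpose m n i}. x $ j)" for i
        by (rule sum.mono_neutral_cong_right) auto
      thus ?thesis by (simp add: matrix_vector_mult_def mat_def)
    qed
    hence eq: "(*v) ?B = (\<lambda>x. \<chi> i. x $ Transposition.transpose m n i)" by blast
    show "P ?B"
    proof (rule unit)
      show "\<bar>det ?B\<bar> = 1"
        by (simp add: det_permute_columns permutes_swap_id sign_swap_id abs_mult)
    qed (unfold eq, rule measure_swap_cbox)
  next
    fix m n :: 'n assume mn: "m \<noteq> n"
    let ?B = "\<chi> i j. of_bool (i = m \<and> j = n \<or> i = j) :: real^'n^'n"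
    have "?B *v x = (\<chi> i. if i = m then x $ m + x $ n else x $ i)" for x :: "real^'n"
    proof -
      have "(\<Sum>j\<in>UNIV. of_bool (i = m \<and> j = n \<or> i = j) * x $ j) =
          (\<Sum>j\<in>(if i = m then {m, n} else {i}). x $ j)" for i
        by (cases "i = m") (auto intro!: sum.mono_neutral_cong_right)
      thus ?thesis using mn by (auto simp: matrix_vector_mult_def vec_eq_iff)
    qed
    hence eq: "(*v) ?B = (\<lambda>x. \<chi> i. if i = m then x $ m + x $ n else x $ i)" by blast
    \<comment> \<open>The shear arises from the identity by adding row \<open>n\<close> to row
      \<open>m\<close>, so its determinant is 1.\<close>
    have "?B = (\<chi> i. if i = m then row m (mat 1) + 1 *s row n (mat 1) else row i (mat 1))"
      using mn by (auto simp: vec_eq_iff row_def mat_def)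
    hence det: "det ?B = 1"
      using det_row_operation[OF mn, of "mat 1" 1] by simp
    show "P ?B"
    proof (rule unit)
      show "\<bar>det ?B\<bar> = 1" unfolding det by simp
    qed (unfold eq, rule measure_shear_cbox[OF mn])
  qed
  thus "(*v) A ` S \<in> lmeasurable" "measure lebesgue ((*v) A ` S) = \<bar>det A\<bar> * measure lebesgue S"
    using assms by (auto simp: P_def)
qed

lemma emeasure_linear_image_unit_cube:
  fixes A :: "real^'d^'d"
  assumes nz: "det A \<noteq> 0" and "((*v) A) ` unit_cube \<in> sets borel"
  shows "emeasure lborel (((*v) A) ` unit_cube) = ennreal \<bar>det A\<bar>"
proof -
  have Q: "(unit_cube :: (real^'d) set) \<in> lmeasurable"
    by (auto simp: fmeasurable_def emeasure_unit_cube)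
  have m: "measure lebesgue (unit_cube :: (real^'d) set) = 1"
    by (simp add: measure_def emeasure_unit_cube)
  have im: "((*v) A) ` unit_cube \<in> lmeasurable"
    by (rule measure_matrix_image(1)[OF nz Q])
  have "measure lebesgue (((*v) A) ` unit_cube) = \<bar>det A\<bar>"
    using measure_matrix_image(2)[OF nz Q] m by simp
  thus ?thesis
    using emeasure_eq_measure2[OF im] assms by simp
qed

text \<open>With \<open>A\<close> the transpose of \<open>M\<close>, multiplication by
  \<open>A\<close> identifies \<open>\<Omega> M\<close> with the set \<open>K\<close> of integer
  points of the parallelepiped \<open>P\<close>. Both \<open>P\<close> and the union
  \<open>P'\<close> of the unit cubes attached to the points of \<open>K\<close> are fundamental
  domains of the lattice \<open>A\<close> spans. Their volumes are \<open>\<bar>det A\<bar>\<close>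
  and the number of points of \<open>K\<close>.\<close>

lemma
  fixes M :: "int^'d^'d"
  assumes "det M \<noteq> 0"
  shows finite_\<Omega>: "finite (\<Omega> M)" and card_\<Omega>: "real (card (\<Omega> M)) = \<bar>real_of_int (det M)\<bar>"
proof -
  define A where "A = transpose (map_matrix real_of_int M)"
  have det: "det A = real_of_int (det M)"
    by (simp add: A_def det_transpose det_map_matrix_of_int)
  hence nz: "det A \<noteq> 0" using assms by simp
  note inv = matrix_inv_mult[OF nz]
  define P where "P = ((*v) A) ` unit_cube"
  have P_iff: "x \<in> P \<longleftrightarrow> matrix_inv A *v x \<in> unit_cube" for x
    unfolding P_def image_iff using inv by metis
  have P_borel: "P \<in> sets borel"
  proof -
    have "(\<lambda>x. matrix_inv A *v x) \<in> borel_measurable borel"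
      by (intro borel_measurable_continuous_onI continuous_intros)
    hence "(\<lambda>x. matrix_inv A *v x) -` unit_cube \<inter> space borel \<in> sets borel"
      by (rule measurable_sets) measurable
    also have "(\<lambda>x. matrix_inv A *v x) -` unit_cube \<inter> space borel = P"
      using P_iff by auto
    finally show ?thesis .
  qed
  define K where "K = {k. int_to_real_vec k \<in> P}"
  \<comment> \<open>The union of the unit cubes with lower corner in \<open>K\<close>; writing it
    with \<open>vfloor\<close> reduces membership of a real point to that of an integer
    point.\<close>
  define P' where "P' = {x. vfloor x \<in> K}"
  have P'_eq: "P' = (\<Union>k\<in>K. {x. - int_to_real_vec k + x \<in> unit_cube})"
    by (auto simp: P'_def diff_in_unit_cube_iff)
  have tr_borel: "{x. - int_to_real_vec k + x \<in> unit_cube} \<in> sets borel" for k :: "int^'d"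
  proof -
    have "(\<lambda>x. - int_to_real_vec k + x) -` unit_cube \<inter> space borel \<in> sets borel" by measurable
    also have "(\<lambda>x. - int_to_real_vec k + x) -` unit_cube \<inter> space borel =
       {x. - int_to_real_vec k + x \<in> unit_cube}" by auto
    finally show ?thesis .
  qed
  have countable: "countable (X :: (int^'d) set)" for X
  proof -
    have "countable ((\<lambda>f. \<chi> i. f i) ` (PiE UNIV (\<lambda>_. UNIV) :: ('d \<Rightarrow> int) set))"
      by (intro countable_image countable_PiE) auto
    moreover have "X \<subseteq> (\<lambda>f. \<chi> i. f i) ` (PiE UNIV (\<lambda>_. UNIV) :: ('d \<Rightarrow> int) set)"
    proof
      fix x assume "x \<in> X"
      show "x \<in> (\<lambda>f. \<chi> i. f i) ` (PiE UNIV (\<lambda>_. UNIV) :: ('d \<Rightarrow> int) set)"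
        by (rule image_eqI[of _ _ "\<lambda>i. x $ i"]) auto
    qed
    ultimately show ?thesis by (rule countable_subset[rotated])
  qed
  have P'_borel: "P' \<in> sets borel"
    unfolding P'_eq using tr_borel by (intro sets.countable_UN'[OF countable]) auto
  define L where "L = range (\<lambda>n. A *v int_to_real_vec n)"
  have P_ex: "\<exists>!l. l \<in> L \<and> x - l \<in> P" for x
  proof -
    have "x - A *v int_to_real_vec n \<in> P \<longleftrightarrow> n = vfloor (matrix_inv A *v x)" for n
      by (simp add: P_iff matrix_vector_mult_diff_distrib inv diff_in_unit_cube_iff)
    thus ?thesis
      unfolding L_def
      by (intro ex1I[of _ "A *v int_to_real_vec (vfloor (matrix_inv A *v x))"]) auto
  qed
  have L_int: "\<exists>k. l = int_to_real_vec k" if "l \<in> L" for l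
    using that unfolding L_def A_def transpose_map_matrix
    by (auto simp flip: int_to_real_vec_mult)
  \<comment> \<open>As \<open>A\<close> has integer entries, \<open>l\<close> is an integer vector
    and commutes with \<open>vfloor\<close>. So \<open>P'\<close> inherits unique representation
    modulo \<open>L\<close> from \<open>P\<close>.\<close>
  have "x - l \<in> P' \<longleftrightarrow> int_to_real_vec (vfloor x) - l \<in> P" if l: "l \<in> L" for x l
  proof -
    obtain k where k: "l = int_to_real_vec k" using L_int l by blast
    have "vfloor (x - l) = vfloor x - k" by (simp add: vfloor_def k vec_eq_iff)
    thus ?thesis by (simp add: P'_def K_def k int_to_real_vec_diff)
  qed
  hence P'_ex: "\<exists>!l. l \<in> L \<and> x - l \<in> P'" for x
    using P_ex[of "int_to_real_vec (vfloor x)"] by metis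
  have "emeasure lborel P' = (\<integral>\<^sup>+k. emeasure lborel {x. - int_to_real_vec k + x \<in> unit_cube} \<partial>count_space K)"
    unfolding P'_eq
  proof (rule emeasure_UN_countable)
    show "disjoint_family_on (\<lambda>k. {x. - int_to_real_vec k + x \<in> unit_cube}) K"
      by (auto simp: disjoint_family_on_def diff_in_unit_cube_iff)
  qed (use countable tr_borel in auto)
  \<comment> \<open>Each cube has volume 1, so the volume of \<open>P'\<close> is the counting
    measure of \<open>K\<close>. This is an extended real, so the finiteness of \<open>K\<close> can
    be deduced from it afterwards.\<close>
  also have "\<dots> = emeasure (count_space K) K"
    by (subst emeasure_lborel_translate) (auto simp: emeasure_unit_cube)
  finally have eK: "emeasure (count_space K) K = emeasure lborel P'" by simp
  also have "emeasure lborel P' = emeasure lborel P"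
  proof (rule emeasure_fundamental_domains[OF _ _ P'_borel P_borel P'_ex P_ex])
    show "countable L" unfolding L_def by (intro countable_image countable)
    show "- l \<in> L" if l: "l \<in> L" for l
    proof -
      obtain n where "l = A *v int_to_real_vec n" using l by (auto simp: L_def)
      hence "- l = A *v int_to_real_vec (- n)"
        by (simp add: int_to_real_vec_minus vec.neg)
      thus ?thesis by (auto simp: L_def)
    qed
  qed
  also have "\<dots> = ennreal \<bar>det A\<bar>"
    using emeasure_linear_image_unit_cube[OF nz] P_borel by (simp add: P_def)
  finally have e: "emeasure (count_space K) K = ennreal \<bar>det A\<bar>" .
  hence finK: "finite K"
    by (cases "finite K") (auto simp: emeasure_count_space_infinite)
  have \<Omega>: "\<Omega> M = (\<lambda>k. matrix_inv A *v int_to_real_vec k) ` K"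
    by (auto simp: \<Omega>_def K_def P_iff A_def unit_cube_def)
  show "finite (\<Omega> M)" unfolding \<Omega> using finK by simp
  have "inj_on (\<lambda>k. matrix_inv A *v int_to_real_vec k) K"
    by (rule inj_onI) (metis inv(2) int_to_real_vec_eq_iff)
  hence "card (\<Omega> M) = card K" unfolding \<Omega> by (rule card_image)
  moreover have "ennreal (real (card K)) = ennreal \<bar>det A\<bar>"
    using e finK by (simp add: emeasure_count_space_finite ennreal_of_nat_eq_real_of_nat)
  ultimately show "real (card (\<Omega> M)) = \<bar>real_of_int (det M)\<bar>"
    by (simp add: det)
qed

subsection \<open>Characters\<close>

definition char_fun :: "int^'d \<Rightarrow> real^'d \<Rightarrow> complex" where
  "char_fun k \<xi> = exp (- \<i> * complex_of_real (int_to_real_vec k \<bullet> \<xi>))"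

lemma char_fun_add: "char_fun (k + m) \<xi> = char_fun k \<xi> * char_fun m \<xi>"
  unfolding char_fun_def exp_add[symmetric]
  by (rule arg_cong[of _ _ exp]) (simp add: int_to_real_vec_add inner_add_left distrib_left)

lemma char_fun_add_right: "char_fun k (\<xi> + \<eta>) = char_fun k \<xi> * char_fun k \<eta>"
  unfolding char_fun_def exp_add[symmetric]
  by (rule arg_cong[of _ _ exp]) (simp add: inner_add_right distrib_left)

lemma char_fun_0 [simp]: "char_fun 0 \<xi> = 1" "char_fun k 0 = 1"
  by (simp_all add: char_fun_def)

lemma cnj_char_fun: "cnj (char_fun k \<xi>) = char_fun (- k) \<xi>"
  unfolding char_fun_def exp_cnj
  by (rule arg_cong[of _ _ exp]) (simp add: int_to_real_vec_minus)

lemma char_fun_neq_0 [simp]: "char_fun k \<xi> \<noteq> 0"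
  by (simp add: char_fun_def)

lemma exp_2pi_eq_1_iff: "exp (- \<i> * complex_of_real (2 * pi * t)) = 1 \<longleftrightarrow> t \<in> \<int>"
proof -
  have *: "- (2 * pi * t) = of_int (2 * n) * pi \<longleftrightarrow> t = of_int (- n)" for n :: int
  proof -
    have "- (2 * pi * t) = of_int (2 * n) * pi \<longleftrightarrow> - (2 * pi * t) - of_int (2 * n) * pi = 0"
      by (rule eq_iff_diff_eq_0)
    also have "- (2 * pi * t) - of_int (2 * n) * pi = - (2 * pi) * (t + of_int n)"
      by (simp add: distrib_left)
    also have "- (2 * pi) * (t + of_int n) = 0 \<longleftrightarrow> t + of_int n = 0"
      using pi_neq_zero by (simp only: mult_eq_0_iff neg_equal_0_iff_equal) simp
    also have "\<dots> \<longleftrightarrow> t = of_int (- n)"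
      by (simp only: of_int_minus eq_neg_iff_add_eq_0)
    finally show ?thesis .
  qed
  have "exp (- \<i> * complex_of_real (2 * pi * t)) = 1 \<longleftrightarrow> (\<exists>n::int. - (2 * pi * t) = of_int (2 * n) * pi)"
    unfolding exp_eq_1 by (rule iffI; elim exE conjE; intro exI conjI) (assumption | simp)+
  also have "\<dots> \<longleftrightarrow> (\<exists>n::int. t = of_int (- n))" unfolding * ..
  also have "\<dots> \<longleftrightarrow> t \<in> \<int>"
  proof
    assume "t \<in> \<int>"
    then obtain m where "t = of_int m" by (rule Ints_cases)
    hence "t = of_int (- (- m))" by simp
    thus "\<exists>n::int. t = of_int (- n)" ..
  qed (use Ints_of_int in blast)
  finally show ?thesis .
qed

lemma char_fun_2pi_eq_1_iff: "char_fun k ((2 * pi) *\<^sub>R \<omega>) = 1 \<longleftrightarrow> int_to_real_vec k \<bullet> \<omega> \<in> \<int>"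
  unfolding char_fun_def inner_scaleR_right by (rule exp_2pi_eq_1_iff)

text \<open>Translate the relation by \<eta> and subtract \<open>char_fun p \<eta>\<close> times the
  original one. The term of \<open>p\<close> disappears, and the coefficient of each other
  \<open>q\<close> is multiplied by \<open>char_fun q \<eta> - char_fun p \<eta>\<close>, which is
  nonzero for an \<eta> adapted to \<open>q\<close>.\<close>

lemma char_fun_linear_independent:
  assumes "finite S" and "\<And>\<xi>. (\<Sum>k\<in>S. c k * char_fun k \<xi>) = 0" and "k \<in> S"
  shows "c k = 0"
  using assms
proof (induction S arbitrary: c k rule: finite_induct)
  case (insert p S)
  have others: "c q = 0" if q: "q \<in> S" for q
  proof -
    have "q \<noteq> p" using insert.hyps q by auto
    then obtain i where i: "q $ i \<noteq> p $ i" unfolding vec_eq_iff by blast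
    \<comment> \<open>Scaled so that \<open>q - p\<close> pairs with \<eta> to \<open>pi\<close>;
      the two characters then differ by the factor -1 at \<eta>.\<close>
    define \<eta> :: "real^'a" where "\<eta> = (pi / real_of_int (q $ i - p $ i)) *\<^sub>R axis i 1"
    have "int_to_real_vec (q - p) \<bullet> \<eta> = real_of_int (q $ i - p $ i) * (pi / real_of_int (q $ i - p $ i))"
      by (simp add: \<eta>_def inner_axis)
    also have "\<dots> = pi"
      using i by (simp only: nonzero_mult_div_cancel_left times_divide_eq_right of_int_eq_0_iff
          right_minus_eq not_False_eq_True)
    finally have "char_fun (q - p) \<eta> = exp (- (\<i> * complex_of_real pi))"
      by (simp only: char_fun_def mult_minus_left)
    hence "char_fun (q - p) \<eta> = -1"
      by (simp only: exp_minus exp_pi_i') simp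
    moreover have "char_fun q \<eta> = char_fun (q - p) \<eta> * char_fun p \<eta>"
      using char_fun_add[of "q - p" p \<eta>] by (simp only: diff_add_cancel)
    ultimately have ne: "char_fun q \<eta> - char_fun p \<eta> \<noteq> 0"
      using char_fun_neq_0[of p \<eta>] by simp
    have "(\<Sum>k\<in>S. (c k * (char_fun k \<eta> - char_fun p \<eta>)) * char_fun k \<xi>) = 0" for \<xi>
    proof -
      have "(\<Sum>k\<in>S. (c k * (char_fun k \<eta> - char_fun p \<eta>)) * char_fun k \<xi>) =
          (\<Sum>k\<in>insert p S. (c k * (char_fun k \<eta> - char_fun p \<eta>)) * char_fun k \<xi>)"
        using insert.hyps by simp
      also have "\<dots> = (\<Sum>k\<in>insert p S. c k * char_fun k (\<xi> + \<eta>)) -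
          char_fun p \<eta> * (\<Sum>k\<in>insert p S. c k * char_fun k \<xi>)"
        unfolding char_fun_add_right sum_distrib_left sum_subtractf[symmetric]
        by (intro sum.cong refl) (simp add: algebra_simps)
      also have "\<dots> = 0" unfolding insert.prems(1) by simp
      finally show ?thesis .
    qed
    hence "c q * (char_fun q \<eta> - char_fun p \<eta>) = 0"
      by (rule insert.IH[of "\<lambda>k. c k * (char_fun k \<eta> - char_fun p \<eta>)", OF _ q])
    thus ?thesis using ne by simp
  qed
  have "c p = (\<Sum>k\<in>insert p S. c k * char_fun k 0)"
    using insert.hyps others by simp
  also have "\<dots> = 0" by (rule insert.prems(1))
  finally have "c p = 0" .
  thus ?case using others insert.prems(2) by auto
qed simp

text \<open>The set where \<open>f\<close> is nonzero is open and null, hence empty. This turns the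
  almost-everywhere condition of the filter bank into one at every point.\<close>

lemma AE_lborel_continuous_eq_0:
  fixes f :: "'a::euclidean_space \<Rightarrow> 'b::real_normed_vector"
  assumes "AE x in lborel. f x = 0" and "continuous_on UNIV f"
  shows "f x = 0"
proof (rule ccontr)
  assume "f x \<noteq> 0"
  have op: "open {x. f x \<noteq> 0}"
    using assms(2) by (intro open_Collect_neq continuous_intros) auto
  have "emeasure lborel {x\<in>space lborel. \<not> f x = 0} = 0"
    using assms(1) op by (subst (asm) AE_iff_measurable[OF _ refl]) auto
  hence "{x. f x \<noteq> 0} \<in> null_sets lborel"
    using op by (auto simp: null_sets_def)
  hence "negligible {x. f x \<noteq> 0}"
    by (simp add: negligible_iff_null_sets null_sets_completionI)
  with open_not_negligible[OF op] \<open>f x \<noteq> 0\<close> show False by blast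
qed

lemma \<Omega>_iff:
  assumes "det M \<noteq> 0"
  shows "\<omega> \<in> \<Omega> M \<longleftrightarrow> \<omega> \<in> unit_cube \<and>
    (\<exists>k. transpose (map_matrix real_of_int M) *v \<omega> = int_to_real_vec k)"
proof -
  let ?A = "transpose (map_matrix real_of_int M)"
  have "det ?A \<noteq> 0" using assms by (simp add: det_transpose det_map_matrix_of_int)
  note inv = matrix_inv_mult[OF this]
  have "(\<exists>k. \<omega> = matrix_inv ?A *v int_to_real_vec k) \<longleftrightarrow> (\<exists>k. ?A *v \<omega> = int_to_real_vec k)"
    using inv by metis
  thus ?thesis by (auto simp: \<Omega>_def unit_cube_def)
qed

lemma zero_in_\<Omega>: "0 \<in> \<Omega> M"
  unfolding \<Omega>_def by (intro IntI range_eqI[of _ _ 0]) auto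

lemma inner_matrix_vector_mult: "(A *v x) \<bullet> y = x \<bullet> (transpose A *v y)" for A :: "real^'n^'m"
  by (metis dot_lmul_matrix inner_commute transpose_matrix_vector transpose_transpose)

lemma inner_int_matrix:
  "int_to_real_vec (M *v n) \<bullet> \<omega> = int_to_real_vec n \<bullet> (transpose (map_matrix real_of_int M) *v \<omega>)"
  unfolding int_to_real_vec_mult by (rule inner_matrix_vector_mult)

text \<open>\<open>\<Omega> M\<close> represents a finite group modulo integer vectors, and
  translation by \<eta> permutes it. Reducing back into the cube changes no value, because a
  character is 1 at \<open>2 * pi\<close> times an integer vector.\<close>

lemma sum_char_fun_shift:
  assumes det: "det M \<noteq> 0"
    and \<eta>: "transpose (map_matrix real_of_int M) *v \<eta> = int_to_real_vec h"
  shows "char_fun k ((2 * pi) *\<^sub>R \<eta>) * (\<Sum>\<omega>\<in>\<Omega> M. char_fun k ((2 * pi) *\<^sub>R \<omega>)) =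
    (\<Sum>\<omega>\<in>\<Omega> M. char_fun k ((2 * pi) *\<^sub>R \<omega>))"
proof -
  let ?A = "transpose (map_matrix real_of_int M)"
  define g where "g \<omega> = \<omega> + \<eta> - int_to_real_vec (vfloor (\<omega> + \<eta>))" for \<omega>
  have g_in: "g ` \<Omega> M \<subseteq> \<Omega> M"
  proof
    fix x assume "x \<in> g ` \<Omega> M"
    then obtain \<omega> where \<omega>: "\<omega> \<in> \<Omega> M" "x = g \<omega>" by auto
    obtain p where "?A *v \<omega> = int_to_real_vec p" using \<omega>(1) \<Omega>_iff[OF det] by blast
    moreover have "?A *v int_to_real_vec (vfloor (\<omega> + \<eta>)) =
        int_to_real_vec (transpose M *v vfloor (\<omega> + \<eta>))"
      by (simp only: int_to_real_vec_mult transpose_map_matrix)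
    ultimately have "?A *v g \<omega> = int_to_real_vec (p + h - transpose M *v vfloor (\<omega> + \<eta>))"
      by (simp only: g_def matrix_vector_mult_diff_distrib matrix_vector_right_distrib \<eta>
          int_to_real_vec_add int_to_real_vec_diff)
    moreover have "g \<omega> \<in> unit_cube" unfolding g_def diff_in_unit_cube_iff ..
    ultimately show "x \<in> \<Omega> M" using \<omega>(2) \<Omega>_iff[OF det] by blast
  qed
  have "inj_on g (\<Omega> M)"
  proof (rule inj_onI)
    fix x y assume xy: "x \<in> \<Omega> M" "y \<in> \<Omega> M" "g x = g y"
    define q where "q = vfloor (x + \<eta>) - vfloor (y + \<eta>)"
    have y: "y = x - int_to_real_vec q"
      using xy(3) by (simp add: g_def q_def int_to_real_vec_diff algebra_simps)
    have "x - int_to_real_vec q \<in> unit_cube" "x - int_to_real_vec 0 \<in> unit_cube"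
      using xy \<Omega>_iff[OF det] y by auto
    hence "q = 0" unfolding diff_in_unit_cube_iff by simp
    thus "x = y" using y by simp
  qed
  hence "(\<Sum>\<omega>\<in>\<Omega> M. char_fun k ((2 * pi) *\<^sub>R \<omega>)) = (\<Sum>\<omega>\<in>\<Omega> M. char_fun k ((2 * pi) *\<^sub>R g \<omega>))"
    using endo_inj_surj[OF finite_\<Omega>[OF det] g_in] sum.reindex[of g "\<Omega> M"] by simp
  also have "\<dots> = (\<Sum>\<omega>\<in>\<Omega> M. char_fun k ((2 * pi) *\<^sub>R \<eta>) * char_fun k ((2 * pi) *\<^sub>R \<omega>))"
  proof (rule sum.cong[OF refl])
    fix \<omega>
    have "(2 * pi) *\<^sub>R g \<omega> = (2 * pi) *\<^sub>R \<eta> + (2 * pi) *\<^sub>R \<omega> +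
        (2 * pi) *\<^sub>R int_to_real_vec (- vfloor (\<omega> + \<eta>))"
      by (simp add: g_def int_to_real_vec_minus algebra_simps)
    moreover have "char_fun k ((2 * pi) *\<^sub>R int_to_real_vec (- vfloor (\<omega> + \<eta>))) = 1"
      unfolding char_fun_2pi_eq_1_iff by (rule int_to_real_vec_inner_Ints)
    ultimately show "char_fun k ((2 * pi) *\<^sub>R g \<omega>) =
        char_fun k ((2 * pi) *\<^sub>R \<eta>) * char_fun k ((2 * pi) *\<^sub>R \<omega>)"
      by (simp only: char_fun_add_right mult_1_right)
  qed
  also have "\<dots> = char_fun k ((2 * pi) *\<^sub>R \<eta>) * (\<Sum>\<omega>\<in>\<Omega> M. char_fun k ((2 * pi) *\<^sub>R \<omega>))"
    by (rule sum_distrib_left[symmetric])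
  finally show ?thesis by (rule sym)
qed

text \<open>Orthogonality of characters: the character of \<open>k\<close> is trivial on the group
  exactly when \<open>k\<close> lies in the lattice of \<open>M\<close>. Otherwise some shift
  multiplies the sum by a factor other than 1, and the sum vanishes.\<close>

lemma sum_char_fun_\<Omega>:
  fixes M :: "int^'d^'d"
  assumes det: "det M \<noteq> 0"
  shows "(\<Sum>\<omega>\<in>\<Omega> M. char_fun k ((2 * pi) *\<^sub>R \<omega>)) =
    (if k \<in> range (\<lambda>n. M *v n) then of_real \<bar>real_of_int (det M)\<bar> else 0)"
proof (cases "k \<in> range (\<lambda>n. M *v n)")
  case True
  then obtain n where k: "k = M *v n" by blast
  have "char_fun k ((2 * pi) *\<^sub>R \<omega>) = 1" if "\<omega> \<in> \<Omega> M" for \<omega>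
    using that int_to_real_vec_inner_Ints unfolding char_fun_2pi_eq_1_iff k inner_int_matrix \<Omega>_iff[OF det]
    by metis
  hence "(\<Sum>\<omega>\<in>\<Omega> M. char_fun k ((2 * pi) *\<^sub>R \<omega>)) = of_real (real (card (\<Omega> M)))"
    by simp
  thus ?thesis using True card_\<Omega>[OF det] by simp
next
  case False
  let ?N = "map_matrix real_of_int M"
  have dets: "det ?N \<noteq> 0" "det (transpose ?N) \<noteq> 0"
    using det by (simp_all add: det_transpose det_map_matrix_of_int)
  note inv = matrix_inv_mult[OF dets(1)] matrix_inv_mult[OF dets(2)]
  define y where "y = matrix_inv ?N *v int_to_real_vec k"
  have Ny: "?N *v y = int_to_real_vec k" by (simp add: y_def inv)
  have "\<exists>i. y $ i \<notin> \<int>"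
  proof (rule ccontr)
    assume "\<not> ?thesis"
    hence "y = int_to_real_vec (vfloor y)"
      by (simp add: vec_eq_iff vfloor_def)
    hence "int_to_real_vec k = int_to_real_vec (M *v vfloor y)"
      using Ny by (simp add: int_to_real_vec_mult)
    thus False using False by simp
  qed
  then obtain i where i: "y $ i \<notin> \<int>" by blast
  \<comment> \<open>Chosen so that \<open>k\<close> pairs with \<eta> to \<open>y $ i\<close>, a
    coordinate of the preimage of \<open>k\<close> under \<open>M\<close> that is not an
    integer.\<close>
  define \<eta> where "\<eta> = matrix_inv (transpose ?N) *v axis i 1"
  have ax: "axis i 1 = int_to_real_vec (axis i 1)" by (simp add: vec_eq_iff axis_def)
  have \<eta>: "transpose ?N *v \<eta> = int_to_real_vec (axis i 1)"
    unfolding \<eta>_def ax by (rule inv(4))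
  have "int_to_real_vec k \<bullet> \<eta> = y \<bullet> (transpose ?N *v \<eta>)"
    by (simp add: Ny[symmetric] inner_matrix_vector_mult)
  also have "\<dots> = y $ i" unfolding \<eta> ax[symmetric] by (simp add: inner_axis)
  finally have "char_fun k ((2 * pi) *\<^sub>R \<eta>) \<noteq> 1"
    using i by (simp add: char_fun_2pi_eq_1_iff)
  thus ?thesis using sum_char_fun_shift[OF det \<eta>, of k] False by simp
qed


subsection \<open>The time-domain identity\<close>

lemma continuous_on_char_fun [continuous_intros]:
  "continuous_on S f \<Longrightarrow> continuous_on S (\<lambda>x. char_fun k (f x))"
  unfolding char_fun_def by (intro continuous_intros)

text \<open>Products of two Fourier series have frequencies \<open>m - k\<close>, which need not be
  distinct. The terms are grouped by frequency before linear independence is applied.\<close>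

lemma trig_poly_coeff_unique:
  assumes K: "finite K"
    and AE: "AE \<xi> in lborel. (\<Sum>(k, m)\<in>K. c k m * char_fun (m - k) \<xi>) = z"
  shows "(\<Sum>(k, m)\<in>{(k, m)\<in>K. m - k = p}. c k m) = (if p = 0 then z else 0)"
proof -
  \<comment> \<open>The frequencies 0 and \<open>p\<close> are inserted because neither need occur
    as a difference from \<open>K\<close>, yet both the constant \<open>z\<close> and the
    coefficient in question must be part of the sum.\<close>
  define P where "P = insert p (insert 0 ((\<lambda>(k, m). m - k) ` K))"
  define C where "C q = (\<Sum>(k, m)\<in>{(k, m)\<in>K. m - k = q}. c k m)" for q
  have P: "finite P" "p \<in> P" "0 \<in> P" using K by (auto simp: P_def)
  have "(\<Sum>q\<in>P. (C q - (if q = 0 then z else 0)) * char_fun q \<xi>) = 0" for \<xi>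
  proof -
    have eq: "(\<Sum>q\<in>P. (C q - (if q = 0 then z else 0)) * char_fun q \<xi>) =
        (\<Sum>(k, m)\<in>K. c k m * char_fun (m - k) \<xi>) - z" for \<xi>
    proof -
      have "(\<Sum>(k, m)\<in>K. c k m * char_fun (m - k) \<xi>) =
          (\<Sum>q\<in>P. \<Sum>(k, m)\<in>{x\<in>K. (\<lambda>(k, m). m - k) x = q}. c k m * char_fun (m - k) \<xi>)"
        by (rule sum.group[symmetric]) (use K P in \<open>auto simp: P_def\<close>)
      also have "\<dots> = (\<Sum>q\<in>P. C q * char_fun q \<xi>)"
      proof (rule sum.cong[OF refl])
        fix q
        show "(\<Sum>(k, m)\<in>{x\<in>K. (\<lambda>(k, m). m - k) x = q}. c k m * char_fun (m - k) \<xi>) = C q * char_fun q \<xi>"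
          unfolding C_def sum_distrib_right by (rule sum.cong) auto
      qed
      finally have "(\<Sum>q\<in>P. C q * char_fun q \<xi>) = (\<Sum>(k, m)\<in>K. c k m * char_fun (m - k) \<xi>)"
        by (rule sym)
      moreover have "(\<Sum>q\<in>P. (if q = 0 then z else 0) * char_fun q \<xi>) = z"
      proof -
        have "(\<Sum>q\<in>P. (if q = 0 then z else 0) * char_fun q \<xi>) = (\<Sum>q\<in>P. if q = 0 then z else 0)"
          by (rule sum.cong) auto
        thus ?thesis using P by simp
      qed
      ultimately show ?thesis by (simp only: left_diff_distrib sum_subtractf)
    qed
    have "AE \<xi> in lborel. (\<Sum>q\<in>P. (C q - (if q = 0 then z else 0)) * char_fun q \<xi>) = 0"
      using AE unfolding eq by simp
    thus ?thesis
      by (rule AE_lborel_continuous_eq_0) (intro continuous_intros)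
  qed
  hence "C p - (if p = 0 then z else 0) = 0"
    by (rule char_fun_linear_independent[of P "\<lambda>q. C q - (if q = 0 then z else 0)", OF P(1) _ P(2)])
  thus ?thesis by (simp add: C_def)
qed

lemma matrix_vector_mult_minus: "M *v (- n) = - (M *v n)" for M :: "'a::ring_1^'n^'m"
  by (simp add: vec_eq_iff matrix_vector_mult_def sum_negf)

text \<open>Scalar form, to be used for each matrix entry separately. The indicators allow the
  differing sets \<open>\<Omega> (M l)\<close> to be summed over their union \<open>U\<close>, so
  that the sums over \<open>l\<close> and \<omega> can be exchanged.\<close>

lemma mixed_filter_identity:
  fixes M :: "'i \<Rightarrow> int^'d^'d" and g :: "'i \<Rightarrow> int^'d \<Rightarrow> int^'d \<Rightarrow> complex"
  assumes I: "finite I" "I \<noteq> {}" and K: "finite K" and det: "\<And>l. l \<in> I \<Longrightarrow> det (M l) \<noteq> 0"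
    and supp: "\<And>l k m. l \<in> I \<Longrightarrow> g l k m \<noteq> 0 \<Longrightarrow> k \<in> K \<and> m \<in> K"
    and AE: "\<And>\<omega>. \<omega> \<in> (\<Union>l\<in>I. \<Omega> (M l)) \<Longrightarrow> AE \<xi> in lborel.
      (\<Sum>l\<in>I. indicat_real (\<Omega> (M l)) \<omega> *\<^sub>R (\<Sum>(k, m)\<in>K \<times> K.
        g l k m * char_fun m ((2 * pi) *\<^sub>R \<omega>) * char_fun (m - k) \<xi>)) = (if \<omega> = 0 then z else 0)"
  shows "(\<Sum>l\<in>I. \<bar>real_of_int (det (M l))\<bar> *\<^sub>R
      (\<Sum>n\<in>(\<lambda>n. y - M l *v n) -` K. g l (x - M l *v n) (y - M l *v n))) = (if x = y then z else 0)"
proof -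
  define U where "U = (\<Union>l\<in>I. \<Omega> (M l))"
  define R where "R = {(k, m)\<in>K \<times> K. m - k = y - x}"
  have finU: "finite U" unfolding U_def by (intro finite_UN_I I finite_\<Omega> det)
  have 0: "0 \<in> U" using I(2) zero_in_\<Omega> by (auto simp: U_def)
  have fR: "finite R" by (rule finite_subset[of _ "K \<times> K"]) (use K in \<open>auto simp: R_def\<close>)
  have coeff: "(\<Sum>(k, m)\<in>R. \<Sum>l\<in>I. indicat_real (\<Omega> (M l)) \<omega> *\<^sub>R (g l k m * char_fun m ((2 * pi) *\<^sub>R \<omega>)))
      = (if x = y \<and> \<omega> = 0 then z else 0)" if \<omega>: "\<omega> \<in> U" for \<omega>
  proof -
    have "(\<Sum>l\<in>I. indicat_real (\<Omega> (M l)) \<omega> *\<^sub>R (\<Sum>(k, m)\<in>K \<times> K.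
        g l k m * char_fun m ((2 * pi) *\<^sub>R \<omega>) * char_fun (m - k) \<xi>)) =
      (\<Sum>(k, m)\<in>K \<times> K. (\<Sum>l\<in>I. indicat_real (\<Omega> (M l)) \<omega> *\<^sub>R
        (g l k m * char_fun m ((2 * pi) *\<^sub>R \<omega>))) * char_fun (m - k) \<xi>)" for \<xi>
      unfolding scaleR_sum_right split_def sum_distrib_right
      by (subst sum.swap) (simp add: split_def)
    hence "AE \<xi> in lborel. (\<Sum>(k, m)\<in>K \<times> K. (\<Sum>l\<in>I. indicat_real (\<Omega> (M l)) \<omega> *\<^sub>R
        (g l k m * char_fun m ((2 * pi) *\<^sub>R \<omega>))) * char_fun (m - k) \<xi>) = (if \<omega> = 0 then z else 0)"
      using AE[of \<omega>] \<omega> by (simp only: U_def)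
    from trig_poly_coeff_unique[OF _ this, of "y - x"] K show ?thesis
      unfolding R_def by (auto split: if_splits)
  qed
  have "(if x = y then z else 0) = (\<Sum>\<omega>\<in>U. if x = y \<and> \<omega> = 0 then z else 0)"
    using finU 0 by simp
  \<comment> \<open>By \<open>coeff\<close> the inner sum vanishes unless \<omega> is 0, where the
    inserted character is 1. The choice of \<open>- y\<close> turns the character of
    \<open>m\<close> into that of \<open>m - y\<close>, and summing over \<omega> will test whether
    \<open>m\<close> lies in the coset of \<open>y\<close>.\<close>
  also have "\<dots> = (\<Sum>\<omega>\<in>U. char_fun (- y) ((2 * pi) *\<^sub>R \<omega>) * (\<Sum>(k, m)\<in>R. \<Sum>l\<in>I.
      indicat_real (\<Omega> (M l)) \<omega> *\<^sub>R (g l k m * char_fun m ((2 * pi) *\<^sub>R \<omega>))))"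
    by (rule sum.cong) (auto simp: coeff)
  also have "\<dots> = (\<Sum>\<omega>\<in>U. \<Sum>l\<in>I. \<Sum>(k, m)\<in>R. g l k m *
      (indicat_real (\<Omega> (M l)) \<omega> *\<^sub>R char_fun (m - y) ((2 * pi) *\<^sub>R \<omega>)))"
  proof (rule sum.cong[OF refl])
    fix \<omega>
    have "char_fun (- y) ((2 * pi) *\<^sub>R \<omega>) * (indicat_real (\<Omega> (M l)) \<omega> *\<^sub>R (g l k m * char_fun m ((2 * pi) *\<^sub>R \<omega>)))
       = g l k m * (indicat_real (\<Omega> (M l)) \<omega> *\<^sub>R char_fun (m - y) ((2 * pi) *\<^sub>R \<omega>))" for l k m
      using char_fun_add[of m "- y" "(2 * pi) *\<^sub>R \<omega>"] by simp
    thus "char_fun (- y) ((2 * pi) *\<^sub>R \<omega>) * (\<Sum>(k, m)\<in>R. \<Sum>l\<in>I.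
        indicat_real (\<Omega> (M l)) \<omega> *\<^sub>R (g l k m * char_fun m ((2 * pi) *\<^sub>R \<omega>))) =
        (\<Sum>l\<in>I. \<Sum>(k, m)\<in>R. g l k m *
      (indicat_real (\<Omega> (M l)) \<omega> *\<^sub>R char_fun (m - y) ((2 * pi) *\<^sub>R \<omega>)))"
      unfolding sum_distrib_left split_def by (subst sum.swap) (simp only:)
  qed
  also have "\<dots> = (\<Sum>l\<in>I. \<Sum>(k, m)\<in>R. g l k m *
      (\<Sum>\<omega>\<in>U. indicat_real (\<Omega> (M l)) \<omega> *\<^sub>R char_fun (m - y) ((2 * pi) *\<^sub>R \<omega>)))"
    unfolding sum_distrib_left split_def
    by (subst sum.swap, rule sum.cong[OF refl], rule sum.swap)
  also have "\<dots> = (\<Sum>l\<in>I. \<bar>real_of_int (det (M l))\<bar> *\<^sub>R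
      (\<Sum>n\<in>(\<lambda>n. y - M l *v n) -` K. g l (x - M l *v n) (y - M l *v n)))"
  proof (rule sum.cong[OF refl])
    fix l assume l: "l \<in> I"
    let ?D = "\<bar>real_of_int (det (M l))\<bar>"
    \<comment> \<open>Parametrizes the surviving pairs: \<open>m = y - M l *v n\<close> forces
      \<open>k = x - M l *v n\<close>, since \<open>m - k = y - x\<close> on
      \<open>R\<close>.\<close>
    define N where "N = {n. x - M l *v n \<in> K \<and> y - M l *v n \<in> K}"
    have inj: "inj (\<lambda>n. y - M l *v n)"
      using inj_int_matrix[OF det[OF l]] by (auto simp: inj_def)
    have "(\<Sum>\<omega>\<in>U. indicat_real (\<Omega> (M l)) \<omega> *\<^sub>R char_fun (m - y) ((2 * pi) *\<^sub>R \<omega>)) =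
        (if m - y \<in> range (\<lambda>n. M l *v n) then of_real ?D else 0)" for m
    proof -
      have "(\<Sum>\<omega>\<in>U. indicat_real (\<Omega> (M l)) \<omega> *\<^sub>R char_fun (m - y) ((2 * pi) *\<^sub>R \<omega>)) =
         (\<Sum>\<omega>\<in>\<Omega> (M l). char_fun (m - y) ((2 * pi) *\<^sub>R \<omega>))"
        by (rule sum.mono_neutral_cong_right[OF finU]) (use l in \<open>auto simp: U_def\<close>)
      thus ?thesis by (simp only: sum_char_fun_\<Omega>[OF det[OF l]])
    qed
    hence "(\<Sum>(k, m)\<in>R. g l k m *
        (\<Sum>\<omega>\<in>U. indicat_real (\<Omega> (M l)) \<omega> *\<^sub>R char_fun (m - y) ((2 * pi) *\<^sub>R \<omega>))) =
        (\<Sum>(k, m)\<in>R. g l k m * (if m - y \<in> range (\<lambda>n. M l *v n) then of_real ?D else 0))"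
      by (simp only:)
    also have "\<dots> = (\<Sum>(k, m)\<in>(\<lambda>n. (x - M l *v n, y - M l *v n)) ` N. of_real ?D * g l k m)"
    proof (rule sum.mono_neutral_cong_right[OF fR])
      show "(\<lambda>n. (x - M l *v n, y - M l *v n)) ` N \<subseteq> R"
        by (auto simp: N_def R_def)
      show "\<forall>i\<in>R - (\<lambda>n. (x - M l *v n, y - M l *v n)) ` N.
          (case i of (k, m) \<Rightarrow> g l k m * (if m - y \<in> range (\<lambda>n. M l *v n) then of_real ?D else 0)) = 0"
      proof (clarify, goal_cases)
        case (1 k m)
        have "m - y \<notin> range (\<lambda>n. M l *v n)"
        proof
          assume "m - y \<in> range (\<lambda>n. M l *v n)"
          then obtain n where "m - y = M l *v n" by blast
          hence m: "m = y - M l *v (- n)" by (simp add: matrix_vector_mult_minus algebra_simps)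
          moreover from m 1(1) have "k = x - M l *v (- n)" by (auto simp: R_def algebra_simps)
          ultimately have "- n \<in> N" "(k, m) = (\<lambda>n. (x - M l *v n, y - M l *v n)) (- n)"
            using 1(1) by (auto simp: R_def N_def)
          with 1(2) show False by blast
        qed
        thus ?case by simp
      qed
      fix i assume "i \<in> (\<lambda>n. (x - M l *v n, y - M l *v n)) ` N"
      then obtain n where i: "i = (x - M l *v n, y - M l *v n)" by blast
      have "y - M l *v n - y = M l *v (- n)" by (simp add: matrix_vector_mult_minus)
      hence "y - M l *v n - y \<in> range (\<lambda>n. M l *v n)" by blast
      thus "(case i of (k, m) \<Rightarrow> g l k m * (if m - y \<in> range (\<lambda>n. M l *v n) then of_real ?D else 0)) =
          (case i of (k, m) \<Rightarrow> of_real ?D * g l k m)"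
        unfolding i prod.case by (simp only: if_True mult.commute)
    qed
    also have "\<dots> = (\<Sum>n\<in>N. of_real ?D * g l (x - M l *v n) (y - M l *v n))"
      by (rule sum.reindex_cong[where l = "\<lambda>n. (x - M l *v n, y - M l *v n)"])
        (use inj in \<open>auto simp: inj_on_def\<close>)
    also have "\<dots> = ?D *\<^sub>R (\<Sum>n\<in>N. g l (x - M l *v n) (y - M l *v n))"
      by (simp only: sum_distrib_left[symmetric] scaleR_conv_of_real)
    \<comment> \<open>The larger index set constrains only the second argument; the indices gained
      have their first argument outside \<open>K\<close>, where \<open>supp\<close> makes
      \<open>g l\<close> zero.\<close>
    also have "(\<Sum>n\<in>N. g l (x - M l *v n) (y - M l *v n)) =
        (\<Sum>n\<in>(\<lambda>n. y - M l *v n) -` K. g l (x - M l *v n) (y - M l *v n))"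
    proof (rule sum.mono_neutral_left)
      show "finite ((\<lambda>n. y - M l *v n) -` K)" using K inj by (rule finite_vimageI)
    qed (use supp[OF l] in \<open>auto simp: N_def\<close>)
    finally show "(\<Sum>(k, m)\<in>R. g l k m *
        (\<Sum>\<omega>\<in>U. indicat_real (\<Omega> (M l)) \<omega> *\<^sub>R char_fun (m - y) ((2 * pi) *\<^sub>R \<omega>))) =
        ?D *\<^sub>R (\<Sum>n\<in>(\<lambda>n. y - M l *v n) -` K. g l (x - M l *v n) (y - M l *v n))" .
  qed
  finally show ?thesis by (rule sym)
qed

subsection \<open>Perfect reconstruction\<close>

lemma fourier_series_nth:
  assumes "finite K" "{k. u k \<noteq> 0} \<subseteq> K"
  shows "fourier_series u \<xi> $ i $ j = (\<Sum>k\<in>K. u k $ i $ j * char_fun k \<xi>)"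
proof -
  have "(\<Sum>\<^sub>\<infinity>k. u k $ i $ j * char_fun k \<xi>) = (\<Sum>\<^sub>\<infinity>k\<in>K. u k $ i $ j * char_fun k \<xi>)"
  proof (rule infsum_cong_neutral)
    fix k assume "k \<in> UNIV - K"
    hence "u k = 0" using assms(2) by blast
    thus "u k $ i $ j * char_fun k \<xi> = 0" by simp
  qed auto
  thus ?thesis
    using assms(1) by (simp add: fourier_series_def char_fun_def)
qed

text \<open>Conjugation reverses the sign of \<open>k\<close>, which gives the frequency
  \<open>m - k\<close>. Only the second series is shifted by \<eta>, hence the additional factor for
  \<open>m\<close> alone.\<close>

lemma conj_transpose_fourier_series_mult:
  fixes b b' :: "int^'d \<Rightarrow> complex^'r^'p"
  assumes K: "finite K" and "{k. b k \<noteq> 0} \<subseteq> K" "{k. b' k \<noteq> 0} \<subseteq> K"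
  shows "(conj_transpose (fourier_series b \<xi>) ** fourier_series b' (\<xi> + \<eta>)) $ i $ j =
    (\<Sum>(k, m)\<in>K \<times> K. (conj_transpose (b k) ** b' m) $ i $ j * char_fun m \<eta> * char_fun (m - k) \<xi>)"
proof -
  have "(conj_transpose (fourier_series b \<xi>) ** fourier_series b' (\<xi> + \<eta>)) $ i $ j =
     (\<Sum>t\<in>UNIV. (\<Sum>k\<in>K. cnj (b k $ t $ i) * char_fun (- k) \<xi>) *
        (\<Sum>m\<in>K. b' m $ t $ j * char_fun m (\<xi> + \<eta>)))"
    by (simp add: matrix_matrix_mult_def conj_transpose_def fourier_series_nth[OF K assms(2)]
        fourier_series_nth[OF K assms(3)] cnj_char_fun)
  also have "\<dots> = (\<Sum>t\<in>UNIV. \<Sum>(k, m)\<in>K \<times> K.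
      (cnj (b k $ t $ i) * b' m $ t $ j) * (char_fun m \<eta> * char_fun (m - k) \<xi>))"
  proof (rule sum.cong[OF refl])
    fix t
    have "cnj (b k $ t $ i) * char_fun (- k) \<xi> * (b' m $ t $ j * char_fun m (\<xi> + \<eta>)) =
        (cnj (b k $ t $ i) * b' m $ t $ j) * (char_fun m \<eta> * char_fun (m - k) \<xi>)" for k m
      using char_fun_add[of m "- k" \<xi>] by (simp add: char_fun_add_right)
    thus "(\<Sum>k\<in>K. cnj (b k $ t $ i) * char_fun (- k) \<xi>) *
        (\<Sum>m\<in>K. b' m $ t $ j * char_fun m (\<xi> + \<eta>)) = (\<Sum>(k, m)\<in>K \<times> K.
      (cnj (b k $ t $ i) * b' m $ t $ j) * (char_fun m \<eta> * char_fun (m - k) \<xi>))"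
      by (simp only: sum_product sum.cartesian_product)
  qed
  also have "\<dots> = (\<Sum>(k, m)\<in>K \<times> K. \<Sum>t\<in>UNIV.
      (cnj (b k $ t $ i) * b' m $ t $ j) * (char_fun m \<eta> * char_fun (m - k) \<xi>))"
    unfolding split_def by (rule sum.swap)
  also have "\<dots> = (\<Sum>(k, m)\<in>K \<times> K. (conj_transpose (b k) ** b' m) $ i $ j * char_fun m \<eta> * char_fun (m - k) \<xi>)"
    by (simp only: matrix_matrix_mult_def conj_transpose_def vec_lambda_beta sum_distrib_right mult.assoc)
  finally show ?thesis .
qed

lemma matrix_matrix_mult_zero [simp]: "A ** 0 = 0" "0 ** A = 0"
  by (simp_all add: matrix_matrix_mult_def vec_eq_iff)

lemma sum_atMost_eq: "(\<Sum>l\<le>s. f l) = f 0 + (\<Sum>l=1..s. f l)" for f :: "nat \<Rightarrow> 'a::comm_monoid_add"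
proof -
  have "{..s} = insert 0 {1..s}" by auto
  thus ?thesis by simp
qed

text \<open>\<open>b0\<close> and \<open>b l\<close> have different matrix types, but both products
  are square of size \<open>r\<close>. This lets one sum over \<open>l \<le> s\<close> treat the
  low-pass and high-pass filters alike.\<close>

definition cross_filter ::
  "(int^'d \<Rightarrow> complex^'r^'r) \<Rightarrow> (nat \<Rightarrow> int^'d \<Rightarrow> complex^'r^1) \<Rightarrow>
    (int^'d \<Rightarrow> complex^'r^'r) \<Rightarrow> (nat \<Rightarrow> int^'d \<Rightarrow> complex^'r^1) \<Rightarrow>
    nat \<Rightarrow> int^'d \<Rightarrow> int^'d \<Rightarrow> complex^'r^'r" where
  "cross_filter b0 b b0' b' l k m =
    (if l = 0 then conj_transpose (b0 k) ** b0' m else conj_transpose (b l k) ** b' l m)"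

lemma dual_framelet_time_domain:
  fixes M :: "nat \<Rightarrow> int^'d^'d"
  assumes dual: "dual_framelet_filter_bank s M b0 b b0' b'"
    and det: "\<And>l. l \<le> s \<Longrightarrow> det (M l) \<noteq> 0"
    and K: "finite K" "{k. b0 k \<noteq> 0} \<subseteq> K" "{k. b0' k \<noteq> 0} \<subseteq> K"
      "\<And>l. l \<in> {1..s} \<Longrightarrow> {k. b l k \<noteq> 0} \<subseteq> K" "\<And>l. l \<in> {1..s} \<Longrightarrow> {k. b' l k \<noteq> 0} \<subseteq> K"
  shows "(\<Sum>l\<le>s. \<bar>real_of_int (det (M l))\<bar> *\<^sub>R (\<Sum>n\<in>(\<lambda>n. y - M l *v n) -` K.
    cross_filter b0 b b0' b' l (x - M l *v n) (y - M l *v n))) = (if x = y then mat 1 else 0)"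
proof -
  let ?G = "cross_filter b0 b b0' b'"
  let ?z = "mat 1 :: complex^'r^'r"
  have G0: "?G l k m = 0" if "l \<le> s" "k \<notin> K \<or> m \<notin> K" for l k m
  proof (cases "l = 0")
    case True
    have "b0 k = 0 \<or> b0' m = 0" using that(2) K(2,3) by blast
    thus ?thesis using True by (auto simp: cross_filter_def)
  next
    case False
    have "b l k = 0 \<or> b' l m = 0" using that False K(4,5)[of l] by auto
    thus ?thesis using False by (auto simp: cross_filter_def)
  qed
  have "(\<Sum>l\<le>s. \<bar>real_of_int (det (M l))\<bar> *\<^sub>R (\<Sum>n\<in>(\<lambda>n. y - M l *v n) -` K.
    ?G l (x - M l *v n) (y - M l *v n) $ i $ j)) = (if x = y then ?z $ i $ j else 0)" for i j
  proof (rule mixed_filter_identity[OF _ _ K(1)])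
    fix l k m assume "l \<in> {..s}" "?G l k m $ i $ j \<noteq> 0"
    thus "k \<in> K \<and> m \<in> K" using G0[of l k m] by (cases "k \<in> K \<and> m \<in> K") simp_all
  next
    fix \<omega> assume \<omega>: "\<omega> \<in> (\<Union>l\<le>s. \<Omega> (M l))"
    have "AE \<xi> in lborel. \<forall>\<omega> \<in> (\<Union>l\<le>s. \<Omega> (M l)).
      indicat_real (\<Omega> (M 0)) \<omega> *\<^sub>R
        (conj_transpose (fourier_series b0 \<xi>) ** fourier_series b0' (\<xi> + (2 * pi) *\<^sub>R \<omega>)) +
      (\<Sum>l=1..s. indicat_real (\<Omega> (M l)) \<omega> *\<^sub>R
        (conj_transpose (fourier_series (b l) \<xi>) ** fourier_series (b' l) (\<xi> + (2 * pi) *\<^sub>R \<omega>)))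
      = (if \<omega> = 0 then mat 1 else 0)"
      using dual unfolding dual_framelet_filter_bank_def .
    thus "AE \<xi> in lborel. (\<Sum>l\<le>s. indicat_real (\<Omega> (M l)) \<omega> *\<^sub>R (\<Sum>(k, m)\<in>K \<times> K.
        ?G l k m $ i $ j * char_fun m ((2 * pi) *\<^sub>R \<omega>) * char_fun (m - k) \<xi>)) =
        (if \<omega> = 0 then ?z $ i $ j else 0)"
    proof (rule AE_mp, intro AE_I2 impI)
      fix \<xi> :: "real^'d"
      assume *: "\<forall>\<omega> \<in> (\<Union>l\<le>s. \<Omega> (M l)). indicat_real (\<Omega> (M 0)) \<omega> *\<^sub>R
        (conj_transpose (fourier_series b0 \<xi>) ** fourier_series b0' (\<xi> + (2 * pi) *\<^sub>R \<omega>)) +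
      (\<Sum>l=1..s. indicat_real (\<Omega> (M l)) \<omega> *\<^sub>R
        (conj_transpose (fourier_series (b l) \<xi>) ** fourier_series (b' l) (\<xi> + (2 * pi) *\<^sub>R \<omega>)))
      = (if \<omega> = 0 then mat 1 else 0)"
      have F: "(\<Sum>(k, m)\<in>K \<times> K. ?G l k m $ i $ j * char_fun m ((2 * pi) *\<^sub>R \<omega>) * char_fun (m - k) \<xi>) =
        (if l = 0 then conj_transpose (fourier_series b0 \<xi>) ** fourier_series b0' (\<xi> + (2 * pi) *\<^sub>R \<omega>)
         else conj_transpose (fourier_series (b l) \<xi>) ** fourier_series (b' l) (\<xi> + (2 * pi) *\<^sub>R \<omega>)) $ i $ j"
        if "l \<le> s" for l
      proof (cases "l = 0")
        case True
        thus ?thesis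
          using conj_transpose_fourier_series_mult[OF K(1-3), of \<xi> _ i j] by (simp add: cross_filter_def)
      next
        case False
        hence l: "l \<in> {1..s}" using that by simp
        show ?thesis
          using False conj_transpose_fourier_series_mult[OF K(1) K(4)[OF l] K(5)[OF l], of \<xi> _ i j]
          by (simp add: cross_filter_def)
      qed
      have "(\<Sum>l\<le>s. indicat_real (\<Omega> (M l)) \<omega> *\<^sub>R (\<Sum>(k, m)\<in>K \<times> K.
        ?G l k m $ i $ j * char_fun m ((2 * pi) *\<^sub>R \<omega>) * char_fun (m - k) \<xi>)) =
        (indicat_real (\<Omega> (M 0)) \<omega> *\<^sub>R
        (conj_transpose (fourier_series b0 \<xi>) ** fourier_series b0' (\<xi> + (2 * pi) *\<^sub>R \<omega>)) +
      (\<Sum>l=1..s. indicat_real (\<Omega> (M l)) \<omega> *\<^sub>R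
        (conj_transpose (fourier_series (b l) \<xi>) ** fourier_series (b' l) (\<xi> + (2 * pi) *\<^sub>R \<omega>)))) $ i $ j"
      proof -
        let ?Q = "\<lambda>l. if l = 0 then conj_transpose (fourier_series b0 \<xi>) ** fourier_series b0' (\<xi> + (2 * pi) *\<^sub>R \<omega>)
         else conj_transpose (fourier_series (b l) \<xi>) ** fourier_series (b' l) (\<xi> + (2 * pi) *\<^sub>R \<omega>)"
        have "(\<Sum>l\<le>s. indicat_real (\<Omega> (M l)) \<omega> *\<^sub>R (\<Sum>(k, m)\<in>K \<times> K.
          ?G l k m $ i $ j * char_fun m ((2 * pi) *\<^sub>R \<omega>) * char_fun (m - k) \<xi>)) =
          (\<Sum>l\<le>s. indicat_real (\<Omega> (M l)) \<omega> *\<^sub>R ?Q l) $ i $ j"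
          unfolding sum_component vector_scaleR_component
          by (intro sum.cong refl) (simp only: F atMost_iff)
        also have "(\<Sum>l\<le>s. indicat_real (\<Omega> (M l)) \<omega> *\<^sub>R ?Q l) =
            indicat_real (\<Omega> (M 0)) \<omega> *\<^sub>R ?Q 0 + (\<Sum>l=1..s. indicat_real (\<Omega> (M l)) \<omega> *\<^sub>R ?Q l)"
          by (rule sum_atMost_eq)
        also have "(\<Sum>l=1..s. indicat_real (\<Omega> (M l)) \<omega> *\<^sub>R ?Q l) =
          (\<Sum>l=1..s. indicat_real (\<Omega> (M l)) \<omega> *\<^sub>R
        (conj_transpose (fourier_series (b l) \<xi>) ** fourier_series (b' l) (\<xi> + (2 * pi) *\<^sub>R \<omega>)))"
          by (intro sum.cong refl) auto
        finally show ?thesis by (simp only: if_True simp_thms)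
      qed
      also have "\<dots> = (if \<omega> = 0 then ?z $ i $ j else 0)"
        using *[rule_format, OF \<omega>] by simp
      finally show "(\<Sum>l\<le>s. indicat_real (\<Omega> (M l)) \<omega> *\<^sub>R (\<Sum>(k, m)\<in>K \<times> K.
        ?G l k m $ i $ j * char_fun m ((2 * pi) *\<^sub>R \<omega>) * char_fun (m - k) \<xi>)) =
        (if \<omega> = 0 then ?z $ i $ j else 0)" .
    qed
  qed (use det in auto)
  thus ?thesis
    by (simp add: vec_eq_iff[of _ "_ :: complex^'r^'r"] vec_eq_iff[of _ "_ :: complex^'r"])
qed

lemma vector_matrix_mult_scaleR_left: "(c *\<^sub>R x) v* A = c *\<^sub>R (x v* A)" for A :: "complex^'q^'p"
  by (simp add: vector_matrix_mult_def vec_eq_iff scaleR_sum_right)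

lemma vector_matrix_mult_scaleR_right: "x v* (c *\<^sub>R A) = c *\<^sub>R (x v* A)" for A :: "complex^'q^'p"
  by (simp add: vector_matrix_mult_def vec_eq_iff scaleR_sum_right)

lemma vector_matrix_mult_sum_left: "(\<Sum>i\<in>I. x i) v* A = (\<Sum>i\<in>I. x i v* A)" for A :: "complex^'q^'p"
  by (simp add: vector_matrix_mult_def vec_eq_iff sum_distrib_right) (intro allI sum.swap)

lemma vector_matrix_mult_sum_right: "x v* (\<Sum>i\<in>I. A i) = (\<Sum>i\<in>I. x v* A i)" for A :: "_ \<Rightarrow> complex^'q^'p"
  by (simp add: vector_matrix_mult_def vec_eq_iff sum_distrib_left) (intro allI sum.swap)

text \<open>Writes the composition as an operator with a matrix kernel; the two square roots
  multiply to the weight \<open>\<bar>det M\<bar>\<close>. \<open>X\<close> may be any finite set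
  containing the points that influence \<open>y\<close>, so that a common one can be chosen for all
  filters.\<close>

lemma subdivision_transition:
  fixes b b' :: "int^'d \<Rightarrow> complex^'r^'p"
  assumes M: "inj (\<lambda>k. M *v k)" and K: "finite K" "{k. b k \<noteq> 0} \<subseteq> K" "{k. b' k \<noteq> 0} \<subseteq> K"
    and X: "finite X" "\<And>x n. y - M *v n \<in> K \<Longrightarrow> x - M *v n \<in> K \<Longrightarrow> x \<in> X"
  shows "subdivision b' M (transition b M u) y = (\<Sum>x\<in>X. u x v* (\<bar>real_of_int (det M)\<bar> *\<^sub>R
    (\<Sum>n\<in>(\<lambda>n. y - M *v n) -` K. conj_transpose (b (x - M *v n)) ** b' (y - M *v n))))"
proof -
  let ?c = "sqrt \<bar>real_of_int (det M)\<bar>"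
  let ?N = "(\<lambda>n. y - M *v n) -` K"
  have finN: "finite ?N"
    by (rule finite_vimageI[OF K(1)]) (use M in \<open>auto simp: inj_def\<close>)
  have tr: "transition b M u n = ?c *\<^sub>R (\<Sum>x\<in>X. u x v* conj_transpose (b (x - M *v n)))" if n: "n \<in> ?N" for n
  proof -
    have "(\<Sum>\<^sub>\<infinity>x. u x v* conj_transpose (b (x - M *v n))) =
        (\<Sum>\<^sub>\<infinity>x\<in>X. u x v* conj_transpose (b (x - M *v n)))"
    proof (rule infsum_cong_neutral)
      fix x assume "x \<in> UNIV - X"
      hence "x - M *v n \<notin> K" using X(2) n by auto
      hence "b (x - M *v n) = 0" using K(2) by blast
      thus "u x v* conj_transpose (b (x - M *v n)) = 0" by simp
    qed auto
    thus ?thesis using X(1) by (simp add: transition_def)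
  qed
  have "(\<Sum>\<^sub>\<infinity>n. transition b M u n v* b' (y - M *v n)) = (\<Sum>\<^sub>\<infinity>n\<in>?N. transition b M u n v* b' (y - M *v n))"
  proof (rule infsum_cong_neutral)
    fix n assume "n \<in> UNIV - ?N"
    hence "b' (y - M *v n) = 0" using K(3) by blast
    thus "transition b M u n v* b' (y - M *v n) = 0" by simp
  qed auto
  hence "subdivision b' M (transition b M u) y = ?c *\<^sub>R (\<Sum>n\<in>?N. transition b M u n v* b' (y - M *v n))"
    using finN by (simp add: subdivision_def)
  also have "(\<Sum>n\<in>?N. transition b M u n v* b' (y - M *v n)) =
      (\<Sum>n\<in>?N. ?c *\<^sub>R (\<Sum>x\<in>X. u x v* (conj_transpose (b (x - M *v n)) ** b' (y - M *v n))))"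
    by (intro sum.cong refl)
      (simp only: tr vector_matrix_mult_scaleR_left vector_matrix_mult_sum_left vector_matrix_mul_assoc)
  also have "?c *\<^sub>R \<dots> = (?c * ?c) *\<^sub>R (\<Sum>n\<in>?N. \<Sum>x\<in>X. u x v* (conj_transpose (b (x - M *v n)) ** b' (y - M *v n)))"
    by (simp only: scaleR_sum_right[symmetric] scaleR_scaleR)
  also have "?c * ?c = \<bar>real_of_int (det M)\<bar>" by simp
  also have "(\<Sum>n\<in>?N. \<Sum>x\<in>X. u x v* (conj_transpose (b (x - M *v n)) ** b' (y - M *v n))) =
     (\<Sum>x\<in>X. \<Sum>n\<in>?N. u x v* (conj_transpose (b (x - M *v n)) ** b' (y - M *v n)))"
    by (rule sum.swap)
  finally show ?thesis
    by (simp only: vector_matrix_mult_scaleR_right vector_matrix_mult_sum_right scaleR_sum_right)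
qed

lemma vector_matrix_mult_mat_1 [simp]: "x v* mat 1 = x" for x :: "complex^'n"
  by (simp add: vector_matrix_mult_def vec_eq_iff mat_def if_distrib cong: if_cong)

text \<open>After summation over the filters the kernel is the identity matrix at
  \<open>x = y\<close> and zero elsewhere. There is no condition on \<open>u\<close>, since all sums
  at a fixed \<open>y\<close> are finite.\<close>

lemma one_level_reconstruction:
  fixes M :: "nat \<Rightarrow> int^'d^'d"
  assumes dual: "dual_framelet_filter_bank s M b0 b b0' b'"
    and det: "\<And>l. l \<le> s \<Longrightarrow> det (M l) \<noteq> 0"
    and fin: "fin_supp b0" "fin_supp b0'"
      "\<And>l. l \<in> {1..s} \<Longrightarrow> fin_supp (b l)" "\<And>l. l \<in> {1..s} \<Longrightarrow> fin_supp (b' l)"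
  shows "subdivision b0' (M 0) (transition b0 (M 0) u) y +
    (\<Sum>l=1..s. subdivision (b' l) (M l) (transition (b l) (M l) u) y) = u y"
proof -
  define K where "K = {k. b0 k \<noteq> 0} \<union> {k. b0' k \<noteq> 0} \<union>
    (\<Union>l\<in>{1..s}. {k. b l k \<noteq> 0} \<union> {k. b' l k \<noteq> 0})"
  have K: "finite K" "{k. b0 k \<noteq> 0} \<subseteq> K" "{k. b0' k \<noteq> 0} \<subseteq> K"
      "\<And>l. l \<in> {1..s} \<Longrightarrow> {k. b l k \<noteq> 0} \<subseteq> K" "\<And>l. l \<in> {1..s} \<Longrightarrow> {k. b' l k \<noteq> 0} \<subseteq> K"
    using fin unfolding K_def fin_supp_def by auto
  have inj: "inj (\<lambda>k. M l *v k)" if "l \<le> s" for l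
    using inj_int_matrix det that by blast
  let ?N = "\<lambda>l. (\<lambda>n. y - M l *v n) -` K"
  \<comment> \<open>All points whose values of \<open>u\<close> can influence position
    \<open>y\<close> through some filter. \<open>y\<close> is inserted so that the point where the
    kernel is the identity surely belongs to \<open>X\<close>.\<close>
  define X where "X = insert y (\<Union>l\<le>s. \<Union>n\<in>?N l. (\<lambda>k. k + M l *v n) ` K)"
  have finN: "finite (?N l)" if "l \<le> s" for l
    by (rule finite_vimageI[OF K(1)]) (use inj[OF that] in \<open>auto simp: inj_def\<close>)
  have X: "finite X" using finN K(1) by (simp add: X_def)
  have Xmem: "x \<in> X" if "l \<le> s" "y - M l *v n \<in> K" "x - M l *v n \<in> K" for l x n
  proof -
    have "x = (x - M l *v n) + M l *v n" by simp
    hence "x \<in> (\<lambda>k. k + M l *v n) ` K" using that(3) by blast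
    thus ?thesis unfolding X_def using that(1,2) by blast
  qed
  define H where "H l x = \<bar>real_of_int (det (M l))\<bar> *\<^sub>R (\<Sum>n\<in>?N l.
    cross_filter b0 b b0' b' l (x - M l *v n) (y - M l *v n))" for l x
  have H_sum: "(\<Sum>l\<le>s. H l x) = (if x = y then mat 1 else 0)" for x
    unfolding H_def by (rule dual_framelet_time_domain[OF dual det K])
  have "subdivision b0' (M 0) (transition b0 (M 0) u) y = (\<Sum>x\<in>X. u x v* H 0 x)"
    by (subst subdivision_transition[OF inj K(1-3) X Xmem]) (auto simp: H_def cross_filter_def)
  moreover have "subdivision (b' l) (M l) (transition (b l) (M l) u) y = (\<Sum>x\<in>X. u x v* H l x)"
    if l: "l \<in> {1..s}" for l
    by (subst subdivision_transition[OF inj K(1) K(4)[OF l] K(5)[OF l] X Xmem])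
      (use l in \<open>auto simp: H_def cross_filter_def\<close>)
  ultimately have "subdivision b0' (M 0) (transition b0 (M 0) u) y +
    (\<Sum>l=1..s. subdivision (b' l) (M l) (transition (b l) (M l) u) y) = (\<Sum>l\<le>s. \<Sum>x\<in>X. u x v* H l x)"
    by (simp add: sum_atMost_eq)
  also have "\<dots> = (\<Sum>x\<in>X. u x v* (\<Sum>l\<le>s. H l x))"
    unfolding vector_matrix_mult_sum_right by (rule sum.swap)
  also have "\<dots> = (\<Sum>x\<in>X. u x v* (if x = y then mat 1 else 0))"
    by (simp only: H_sum)
  also have "\<dots> = (\<Sum>x\<in>{y}. u x)"
    by (rule sum.mono_neutral_cong_right) (use X in \<open>auto simp: X_def\<close>)
  finally show ?thesis by simp
qed

subsection \<open>The multilevel operators\<close>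

definition coeffs_ip :: "nat \<Rightarrow> nat \<Rightarrow> ('d::finite, 'r::finite) coeffs \<Rightarrow> ('d, 'r) coeffs \<Rightarrow> real" where
  "coeffs_ip s J x y = (\<Sum>j=1..J. \<Sum>l=1..s. ip (fst x l j) (fst y l j)) + ip (snd x) (snd y)"

lemma coeffs_norm_nonneg [simp]: "0 \<le> coeffs_norm s J x"
  by (auto simp: coeffs_norm_def intro!: add_nonneg_nonneg sum_nonneg)

lemma coeffs_norm_power2:
  "(coeffs_norm s J x)\<^sup>2 = (\<Sum>j=1..J. \<Sum>l=1..s. (l2_norm (fst x l j))\<^sup>2) + (l2_norm (snd x))\<^sup>2"
  by (auto simp: coeffs_norm_def intro!: add_nonneg_nonneg sum_nonneg)

lemma coeffs_ip_self: "coeffs_ip s J x x = (coeffs_norm s J x)\<^sup>2"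
  by (simp add: coeffs_ip_def coeffs_norm_power2 ip_self)

text \<open>Cauchy-Schwarz at three levels: for each pair of sequences, over the finite set of
  indices \<open>(j, l)\<close>, and in the plane whose axes carry the total detail norm and the
  low-pass norm.\<close>

lemma coeffs_ip_Cauchy_Schwarz:
  assumes x: "x \<in> coeffs_l2 s J" and y: "y \<in> coeffs_l2 s J"
  shows "coeffs_ip s J x y \<le> coeffs_norm s J x * coeffs_norm s J y"
proof -
  let ?I = "{1..J} \<times> {1..s}"
  let ?f = "\<lambda>x (j, l). l2_norm (fst x l j)"
  have L2: "(L2_set (?f x) ?I)\<^sup>2 = (\<Sum>j=1..J. \<Sum>l=1..s. (l2_norm (fst x l j))\<^sup>2)"
    for x :: "('a, 'b) coeffs"
    by (simp add: L2_set_def sum_nonneg sum.cartesian_product split_def)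
  have norm: "coeffs_norm s J x = norm (L2_set (?f x) ?I, l2_norm (snd x))" for x :: "('a, 'b) coeffs"
    unfolding coeffs_norm_def norm_Pair L2[symmetric] by simp
  have "coeffs_ip s J x y = (\<Sum>(j, l)\<in>?I. ip (fst x l j) (fst y l j)) + ip (snd x) (snd y)"
    by (simp add: coeffs_ip_def sum.cartesian_product)
  also have "\<dots> \<le> (\<Sum>i\<in>?I. \<bar>?f x i\<bar> * \<bar>?f y i\<bar>) + l2_norm (snd x) * l2_norm (snd y)"
  proof (intro add_mono sum_mono ip_Cauchy_Schwarz)
    fix i assume "i \<in> ?I"
    then obtain j l where i: "i = (j, l)" "j \<in> {1..J}" "l \<in> {1..s}" by blast
    have "ip (fst x l j) (fst y l j) \<le> l2_norm (fst x l j) * l2_norm (fst y l j)"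
      by (rule ip_Cauchy_Schwarz) (use x y i in \<open>auto simp: coeffs_l2_def\<close>)
    thus "(case i of (j, l) \<Rightarrow> ip (fst x l j) (fst y l j)) \<le> \<bar>?f x i\<bar> * \<bar>?f y i\<bar>"
      by (simp add: i)
  qed (use x y in \<open>auto simp: coeffs_l2_def\<close>)
  also have "\<dots> \<le> L2_set (?f x) ?I * L2_set (?f y) ?I + l2_norm (snd x) * l2_norm (snd y)"
    by (intro add_right_mono L2_set_mult_ineq)
  also have "\<dots> = (L2_set (?f x) ?I, l2_norm (snd x)) \<bullet> (L2_set (?f y) ?I, l2_norm (snd y))"
    by simp
  also have "\<dots> \<le> coeffs_norm s J x * coeffs_norm s J y"
    unfolding norm by (rule norm_cauchy_schwarz)
  finally show ?thesis .
qed

section \<open>Homogeneity and operator norms\<close>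

lemma transition_scaleR: "transition b M (\<lambda>k. c *\<^sub>R u k) = (\<lambda>n. c *\<^sub>R transition b M u n)"
  by (rule ext) (simp add: transition_def vector_matrix_mult_scaleR_left infsum_scaleR_right)

lemma subdivision_scaleR: "subdivision b M (\<lambda>k. c *\<^sub>R u k) = (\<lambda>n. c *\<^sub>R subdivision b M u n)"
  by (rule ext) (simp add: subdivision_def vector_matrix_mult_scaleR_left infsum_scaleR_right)

lemma low_pass_scaleR: "low_pass b0 M0 (\<lambda>k. c *\<^sub>R u k) j = (\<lambda>k. c *\<^sub>R low_pass b0 M0 u j k)"
  by (induction j) (simp_all add: transition_scaleR)

lemma synth_from_scaleR:
  "synth_from s M b0 b (\<lambda>l j k. c *\<^sub>R w l j k) j (\<lambda>k. c *\<^sub>R w0 k) =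
    (\<lambda>k. c *\<^sub>R synth_from s M b0 b w j w0 k)"
proof (induction j arbitrary: w0)
  case (Suc j)
  have "(\<lambda>n. subdivision b0 (M 0) (\<lambda>k. c *\<^sub>R w0 k) n +
        (\<Sum>l=1..s. subdivision (b l) (M l) (\<lambda>k. c *\<^sub>R w l (Suc j) k) n)) =
      (\<lambda>n. c *\<^sub>R (subdivision b0 (M 0) w0 n + (\<Sum>l=1..s. subdivision (b l) (M l) (w l (Suc j)) n)))"
    by (rule ext) (simp add: subdivision_scaleR scaleR_add_right scaleR_sum_right)
  thus ?case by (simp add: Suc.IH)
qed simp

definition coeffs_scaleR :: "real \<Rightarrow> ('d::finite, 'r::finite) coeffs \<Rightarrow> ('d, 'r) coeffs" where
  "coeffs_scaleR c w = (\<lambda>l j k. c *\<^sub>R fst w l j k, \<lambda>k. c *\<^sub>R snd w k)"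

lemma coeffs_norm_scaleR: "coeffs_norm s J (coeffs_scaleR c w) = \<bar>c\<bar> * coeffs_norm s J w"
proof (rule power2_eq_imp_eq)
  show "(coeffs_norm s J (coeffs_scaleR c w))\<^sup>2 = (\<bar>c\<bar> * coeffs_norm s J w)\<^sup>2"
    by (simp add: coeffs_norm_power2 coeffs_scaleR_def power_mult_distrib sum_distrib_left distrib_left)
qed auto

lemma coeffs_l2_scaleR: "w \<in> coeffs_l2 s J \<Longrightarrow> coeffs_scaleR c w \<in> coeffs_l2 s J"
  by (auto simp: coeffs_l2_def coeffs_scaleR_def intro: l2_scaleR)

lemma analysis_scaleR:
  "analysis s M b0 b J (\<lambda>k. c *\<^sub>R v k) = coeffs_scaleR c (analysis s M b0 b J v)"
  by (auto simp: analysis_def coeffs_scaleR_def low_pass_scaleR transition_scaleR fun_eq_iff)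

lemma synthesis_scaleR:
  "synthesis s M b0 b J (coeffs_scaleR c w) = (\<lambda>k. c *\<^sub>R synthesis s M b0 b J w k)"
  by (simp add: synthesis_def coeffs_scaleR_def synth_from_scaleR)

text \<open>
  Boundedness of \<open>T\<close> is needed because \<^const>\<open>operator_norm\<close> is a supremum in the reals,
  which says nothing about an unbounded set.
\<close>

lemma operator_norm_power2_le_iff:
  fixes nA :: "'a \<Rightarrow> real" and nB :: "'b \<Rightarrow> real" and sc :: "real \<Rightarrow> 'a \<Rightarrow> 'a"
  assumes zero: "z \<in> A" "nA z = 0" and nn: "\<And>x. 0 \<le> nA x" "\<And>y. 0 \<le> nB y"
    and bdd: "\<And>x. x \<in> A \<Longrightarrow> nB (T x) \<le> B * nA x"
    and sc: "\<And>c x. x \<in> A \<Longrightarrow> sc c x \<in> A" "\<And>c x. nA (sc c x) = \<bar>c\<bar> * nA x"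
      "\<And>c x. nB (T (sc c x)) = \<bar>c\<bar> * nB (T x)"
    and C: "0 \<le> C"
  shows "(operator_norm A nA nB T)\<^sup>2 \<le> C \<longleftrightarrow> (\<forall>x\<in>A. nB (T x) \<le> sqrt C * nA x)"
proof -
  let ?S = "{x\<in>A. nA x \<le> 1}"
  let ?N = "operator_norm A nA nB T"
  have zS: "z \<in> ?S" using zero by simp
  have "bdd_above ((\<lambda>x. nB (T x)) ` ?S)"
  proof (rule bdd_aboveI2)
    fix x assume x: "x \<in> ?S"
    have "nB (T x) \<le> B * nA x" using bdd x by simp
    also have "\<dots> \<le> \<bar>B\<bar> * 1"
      using x nn(1)[of x] by (intro mult_mono) auto
    finally show "nB (T x) \<le> \<bar>B\<bar> * 1" .
  qed
  hence upper: "nB (T x) \<le> ?N" if "x \<in> ?S" for x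
    unfolding operator_norm_def using that by (intro cSUP_upper)
  have "0 \<le> ?N" using upper[OF zS] nn(2)[of "T z"] by linarith
  hence "?N\<^sup>2 \<le> C \<longleftrightarrow> ?N \<le> sqrt C"
    using C by (metis real_sqrt_le_iff real_sqrt_unique)
  also have "\<dots> \<longleftrightarrow> (\<forall>x\<in>A. nB (T x) \<le> sqrt C * nA x)"
  proof
    assume le: "?N \<le> sqrt C"
    show "\<forall>x\<in>A. nB (T x) \<le> sqrt C * nA x"
    proof
      fix x assume x: "x \<in> A"
      show "nB (T x) \<le> sqrt C * nA x"
      \<comment> \<open>Such an \<open>x\<close> cannot be normalized; there the assumed bound
        already forces \<open>nB (T x)\<close> to be at most 0.\<close>
      proof (cases "nA x = 0")
        case True
        thus ?thesis using bdd[OF x] by simp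
      next
        case False
        hence pos: "0 < nA x" using nn(1)[of x] by simp
        have "sc (1 / nA x) x \<in> ?S" using sc(1,2) x pos by simp
        from upper[OF this] le have "\<bar>1 / nA x\<bar> * nB (T x) \<le> sqrt C" unfolding sc(3) by simp
        thus ?thesis using pos by (simp add: field_simps)
      qed
    qed
  next
    assume le: "\<forall>x\<in>A. nB (T x) \<le> sqrt C * nA x"
    show "?N \<le> sqrt C"
      unfolding operator_norm_def
    proof (rule cSUP_least)
      show "?S \<noteq> {}" using zS by blast
      fix x assume x: "x \<in> ?S"
      have "nB (T x) \<le> sqrt C * nA x" using le x by simp
      also have "\<dots> \<le> sqrt C * 1" using x C by (intro mult_left_mono) auto
      finally show "nB (T x) \<le> sqrt C" by simp
    qed
  qed
  finally show ?thesis .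
qed

text \<open>Cancels a norm \<open>n\<close> that may be zero, as the duality arguments below
  require.\<close>

lemma le_if_mult_self_le:
  fixes n a :: real
  assumes "n * n \<le> a * n" "0 \<le> a"
  shows "n \<le> a"
proof (rule ccontr)
  assume "\<not> n \<le> a"
  hence "a < n" "0 < n" using assms(2) by auto
  hence "a * n < n * n" by (rule mult_strict_right_mono)
  thus False using assms(1) by simp
qed

text \<open>Collects what holds for a single bank without duality; the theorem interprets it once
  for \<open>b\<close> and once for \<open>b'\<close>.\<close>

locale filter_bank =
  fixes s :: nat and M :: "nat \<Rightarrow> int^'d^'d"
    and b0 :: "int^'d \<Rightarrow> complex^'r^'r" and b :: "nat \<Rightarrow> int^'d \<Rightarrow> complex^'r^1"
  assumes fin_supp: "fin_supp b0" "\<And>l. l \<in> {1..s} \<Longrightarrow> fin_supp (b l)"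
    and inj: "\<And>l. l \<le> s \<Longrightarrow> inj (\<lambda>k. M l *v k)"
begin

abbreviation "W \<equiv> analysis s M b0 b"
abbreviation "V \<equiv> synthesis s M b0 b"
abbreviation "low \<equiv> low_pass b0 (M 0)"

text \<open>The constant may grow with \<open>j\<close>. It only ensures that the operator norms are
  suprema of bounded sets; uniformity over levels is what the statements (1)-(5) are about.\<close>

lemma low_pass_bounded: "\<exists>B\<ge>0. \<forall>v\<in>l2. low v j \<in> l2 \<and> l2_norm (low v j) \<le> B * l2_norm v"
proof (induction j)
  case 0
  show ?case by (intro exI[of _ 1]) auto
next
  case (Suc j)
  then obtain B where B: "B \<ge> 0" "\<forall>v\<in>l2. low v j \<in> l2 \<and> l2_norm (low v j) \<le> B * l2_norm v" by auto
  obtain B' where B': "B' \<ge> 0" "\<forall>u\<in>l2. transition b0 (M 0) u \<in> l2 \<and>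
      l2_norm (transition b0 (M 0) u) \<le> B' * l2_norm u"
    using transition_bounded[OF inj fin_supp(1), of 0] by auto
  show ?case
  proof (intro exI[of _ "B' * B"] conjI ballI)
    fix v :: "int^'d \<Rightarrow> complex^'r" assume v: "v \<in> l2"
    have low: "low v j \<in> l2" "l2_norm (low v j) \<le> B * l2_norm v" using B(2) v by auto
    show "low v (Suc j) \<in> l2" using B'(2) low(1) by simp
    have "l2_norm (low v (Suc j)) \<le> B' * l2_norm (low v j)" using B'(2) low(1) by simp
    also have "\<dots> \<le> B' * (B * l2_norm v)" using low(2) B'(1) by (rule mult_left_mono)
    finally show "l2_norm (low v (Suc j)) \<le> B' * B * l2_norm v" by (simp add: mult.assoc)
  qed (use B(1) B'(1) in simp)
qed

lemma low_pass_l2: "v \<in> l2 \<Longrightarrow> low v j \<in> l2"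
  using low_pass_bounded[of j] by auto

lemma analysis_l2: "v \<in> l2 \<Longrightarrow> W J v \<in> coeffs_l2 s J"
  by (auto simp: coeffs_l2_def analysis_def intro!: transition_l2 inj fin_supp low_pass_l2)

lemma detail_bounded:
  assumes l: "l \<in> {1..s}"
  shows "\<exists>B\<ge>0. \<forall>v\<in>l2. l2_norm (transition (b l) (M l) (low v j)) \<le> B * l2_norm v"
proof -
  obtain B where B: "B \<ge> 0" "\<forall>v\<in>l2. low v j \<in> l2 \<and> l2_norm (low v j) \<le> B * l2_norm v"
    using low_pass_bounded[of j] by auto
  obtain B' where B': "B' \<ge> 0" "\<forall>u\<in>l2. transition (b l) (M l) u \<in> l2 \<and>
      l2_norm (transition (b l) (M l) u) \<le> B' * l2_norm u"
    using transition_bounded[OF inj fin_supp(2)[OF l], of l] l by auto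
  show ?thesis
  proof (intro exI[of _ "B' * B"] conjI ballI)
    fix v :: "int^'d \<Rightarrow> complex^'r" assume v: "v \<in> l2"
    have low: "low v j \<in> l2" "l2_norm (low v j) \<le> B * l2_norm v" using B(2) v by auto
    have "l2_norm (transition (b l) (M l) (low v j)) \<le> B' * l2_norm (low v j)" using B'(2) low(1) by simp
    also have "\<dots> \<le> B' * (B * l2_norm v)" using low(2) B'(1) by (rule mult_left_mono)
    finally show "l2_norm (transition (b l) (M l) (low v j)) \<le> B' * B * l2_norm v" by (simp add: mult.assoc)
  qed (use B(1) B'(1) in simp)
qed

lemma analysis_bounded: "\<exists>B\<ge>0. \<forall>v\<in>l2. coeffs_norm s J (W J v) \<le> B * l2_norm v"
proof -
  obtain B0 where B0: "B0 \<ge> 0" "\<forall>v\<in>l2. low v J \<in> l2 \<and> l2_norm (low v J) \<le> B0 * l2_norm v"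
    using low_pass_bounded[of J] by auto
  \<comment> \<open>The range of \<open>l\<close> sits inside the formula so that a constant exists
    for every \<open>l\<close> and \<open>j\<close>, and a function \<open>B\<close> can be
    chosen.\<close>
  have "\<exists>B. \<forall>v\<in>l2. l \<in> {1..s} \<longrightarrow> l2_norm (transition (b l) (M l) (low v (j - 1))) \<le> B * l2_norm v" for l j
    using detail_bounded[of l "j - 1"] by (cases "l \<in> {1..s}") auto
  then obtain B where B: "\<And>l j v. v \<in> l2 \<Longrightarrow> l \<in> {1..s} \<Longrightarrow>
      l2_norm (transition (b l) (M l) (low v (j - 1))) \<le> B l j * l2_norm v"
    by metis
  define Q where "Q = (\<Sum>j=1..J. \<Sum>l=1..s. (B l j)\<^sup>2) + B0\<^sup>2"
  have Q: "0 \<le> Q" unfolding Q_def by (intro add_nonneg_nonneg sum_nonneg) auto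
  show ?thesis
  proof (intro exI[of _ "sqrt Q"] conjI ballI)
    fix v :: "int^'d \<Rightarrow> complex^'r" assume v: "v \<in> l2"
    have "(coeffs_norm s J (W J v))\<^sup>2 = (\<Sum>j=1..J. \<Sum>l=1..s.
        (l2_norm (transition (b l) (M l) (low v (j - 1))))\<^sup>2) + (l2_norm (low v J))\<^sup>2"
      by (simp add: coeffs_norm_power2 analysis_def)
    also have "\<dots> \<le> (\<Sum>j=1..J. \<Sum>l=1..s. (B l j * l2_norm v)\<^sup>2) + (B0 * l2_norm v)\<^sup>2"
      by (intro add_mono sum_mono power_mono B v) (use B0 v in auto)
    also have "\<dots> = (sqrt Q * l2_norm v)\<^sup>2"
      using Q by (simp add: Q_def power_mult_distrib sum_distrib_right distrib_right)
    finally show "coeffs_norm s J (W J v) \<le> sqrt Q * l2_norm v"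
      by (rule power2_le_imp_le) (use Q in simp)
  qed (use Q in simp)
qed

lemma synthesis_step_l2:
  assumes "w0 \<in> l2" "\<And>l. l \<in> {1..s} \<Longrightarrow> w l \<in> l2"
  shows "(\<lambda>n. subdivision b0 (M 0) w0 n + (\<Sum>l=1..s. subdivision (b l) (M l) (w l) n)) \<in> l2"
  by (intro l2_add l2_sum subdivision_l2 inj fin_supp assms) auto

lemma synth_from_l2:
  assumes "w0 \<in> l2" "\<And>l i. l \<in> {1..s} \<Longrightarrow> i \<in> {1..j} \<Longrightarrow> w l i \<in> l2"
  shows "synth_from s M b0 b w j w0 \<in> l2"
  using assms
proof (induction j arbitrary: w0)
  case (Suc j)
  show ?case
    unfolding synth_from.simps
  proof (rule Suc.IH)
    show "(\<lambda>n. subdivision b0 (M 0) w0 n + (\<Sum>l=1..s. subdivision (b l) (M l) (w l (Suc j)) n)) \<in> l2"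
      by (rule synthesis_step_l2) (use Suc.prems in auto)
  qed (use Suc.prems in auto)
qed simp

lemma synthesis_l2: "w \<in> coeffs_l2 s J \<Longrightarrow> V J w \<in> l2"
  unfolding synthesis_def by (rule synth_from_l2) (auto simp: coeffs_l2_def)

text \<open>\<open>synth_from\<close> first merges level \<open>Suc j\<close> into a new low-pass
  sequence, hence the induction with \<open>w0\<close> arbitrary. Moving this one step across
  \<open>ip\<close> turns \<open>low v j\<close> into its transitions, the analysis coefficients of
  level \<open>Suc j\<close>.\<close>

lemma ip_synth_from:
  assumes "v \<in> l2" "w0 \<in> l2" "\<And>l i. l \<in> {1..s} \<Longrightarrow> i \<in> {1..j} \<Longrightarrow> w l i \<in> l2"
  shows "ip v (synth_from s M b0 b w j w0) =
    (\<Sum>i=1..j. \<Sum>l=1..s. ip (transition (b l) (M l) (low v (i - 1))) (w l i)) + ip (low v j) w0"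
  using assms(2,3)
proof (induction j arbitrary: w0)
  case (Suc j)
  let ?w1 = "\<lambda>n. subdivision b0 (M 0) w0 n + (\<Sum>l=1..s. subdivision (b l) (M l) (w l (Suc j)) n)"
  have w: "w l (Suc j) \<in> l2" if "l \<in> {1..s}" for l using Suc.prems(2) that by auto
  have low: "low v j \<in> l2" by (rule low_pass_l2[OF assms(1)])
  have "ip v (synth_from s M b0 b w (Suc j) w0) =
      (\<Sum>i=1..j. \<Sum>l=1..s. ip (transition (b l) (M l) (low v (i - 1))) (w l i)) + ip (low v j) ?w1"
    unfolding synth_from.simps
    by (rule Suc.IH[OF synthesis_step_l2]) (use Suc.prems w in auto)
  also have "ip (low v j) ?w1 = ip (low v j) (subdivision b0 (M 0) w0) +
      ip (low v j) (\<lambda>n. \<Sum>l=1..s. subdivision (b l) (M l) (w l (Suc j)) n)"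
    by (intro ip_add_right low l2_sum subdivision_l2 inj fin_supp w Suc.prems(1)) auto
  also have "ip (low v j) (\<lambda>n. \<Sum>l=1..s. subdivision (b l) (M l) (w l (Suc j)) n) =
      (\<Sum>l=1..s. ip (low v j) (subdivision (b l) (M l) (w l (Suc j))))"
    by (intro ip_sum_right low subdivision_l2 inj fin_supp w) auto
  also have "\<dots> = (\<Sum>l=1..s. ip (transition (b l) (M l) (low v j)) (w l (Suc j)))"
    by (intro sum.cong refl ip_subdivision inj fin_supp w low) auto
  also have "ip (low v j) (subdivision b0 (M 0) w0) = ip (low v (Suc j)) w0"
    using ip_subdivision[OF inj fin_supp(1) Suc.prems(1) low, of 0] by simp
  finally show ?case by simp
qed simp

lemma ip_synthesis:
  assumes "v \<in> l2" "w \<in> coeffs_l2 s J"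
  shows "ip v (V J w) = coeffs_ip s J (W J v) w"
proof -
  have "ip v (V J w) = (\<Sum>j=1..J. \<Sum>l=1..s. ip (transition (b l) (M l) (low v (j - 1))) (fst w l j)) +
      ip (low v J) (snd w)"
    unfolding synthesis_def by (rule ip_synth_from) (use assms in \<open>auto simp: coeffs_l2_def\<close>)
  thus ?thesis by (simp add: coeffs_ip_def analysis_def)
qed

text \<open>An operator and its adjoint have the same bounds: test the adjoint relation on
  \<open>w = W J v\<close> for one direction and on \<open>v = V J w\<close> for the other.\<close>

lemma analysis_synthesis_bound_iff:
  assumes "0 \<le> c"
  shows "(\<forall>w\<in>coeffs_l2 s J. l2_norm (V J w) \<le> c * coeffs_norm s J w) \<longleftrightarrow>
    (\<forall>v\<in>l2. coeffs_norm s J (W J v) \<le> c * l2_norm v)"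
proof (intro iffI ballI)
  fix v :: "int^'d \<Rightarrow> complex^'r" assume v: "v \<in> l2"
  assume le: "\<forall>w\<in>coeffs_l2 s J. l2_norm (V J w) \<le> c * coeffs_norm s J w"
  let ?n = "coeffs_norm s J (W J v)"
  note Wv = analysis_l2[OF v, of J]
  have "?n * ?n = ip v (V J (W J v))"
    by (simp add: ip_synthesis[OF v Wv] coeffs_ip_self power2_eq_square)
  also have "\<dots> \<le> l2_norm v * l2_norm (V J (W J v))"
    by (rule ip_Cauchy_Schwarz[OF v synthesis_l2[OF Wv]])
  also have "\<dots> \<le> l2_norm v * (c * ?n)"
    using le Wv by (intro mult_left_mono) auto
  finally have "?n * ?n \<le> (c * l2_norm v) * ?n" by (simp add: mult_ac)
  moreover have "0 \<le> c * l2_norm v" using assms by simp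
  ultimately show "?n \<le> c * l2_norm v"
    by (rule le_if_mult_self_le)
next
  fix w :: "('d, 'r) coeffs" assume w: "w \<in> coeffs_l2 s J"
  assume le: "\<forall>v\<in>l2. coeffs_norm s J (W J v) \<le> c * l2_norm v"
  let ?n = "l2_norm (V J w)"
  note Vw = synthesis_l2[OF w]
  have "?n * ?n = coeffs_ip s J (W J (V J w)) w"
    by (simp add: ip_synthesis[OF Vw w, symmetric] ip_self power2_eq_square)
  also have "\<dots> \<le> coeffs_norm s J (W J (V J w)) * coeffs_norm s J w"
    by (rule coeffs_ip_Cauchy_Schwarz[OF analysis_l2[OF Vw] w])
  also have "\<dots> \<le> (c * ?n) * coeffs_norm s J w"
    using le Vw by (intro mult_right_mono) auto
  finally have "?n * ?n \<le> (c * coeffs_norm s J w) * ?n" by (simp add: mult_ac)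
  moreover have "0 \<le> c * coeffs_norm s J w" using assms by simp
  ultimately show "?n \<le> c * coeffs_norm s J w"
    by (rule le_if_mult_self_le)
qed

lemma analysis_norm_le_iff:
  assumes "0 \<le> C"
  shows "(analysis_norm s M b0 b J)\<^sup>2 \<le> C \<longleftrightarrow> (\<forall>v\<in>l2. coeffs_norm s J (W J v) \<le> sqrt C * l2_norm v)"
proof -
  obtain B where B: "\<forall>v\<in>l2. coeffs_norm s J (W J v) \<le> B * l2_norm v"
    using analysis_bounded[of J] by auto
  show ?thesis
    unfolding analysis_norm_def
  proof (rule operator_norm_power2_le_iff[where z = "\<lambda>_. 0" and sc = "\<lambda>c v k. c *\<^sub>R v k" and B = B])
    show "coeffs_norm s J (W J (\<lambda>k. c *\<^sub>R v k)) = \<bar>c\<bar> * coeffs_norm s J (W J v)" for c v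
      by (simp only: analysis_scaleR coeffs_norm_scaleR)
  qed (use B assms in \<open>auto intro: l2_scaleR\<close>)
qed

lemma synthesis_norm_le_iff:
  assumes "0 \<le> C"
  shows "(synthesis_norm s M b0 b J)\<^sup>2 \<le> C \<longleftrightarrow> (\<forall>v\<in>l2. coeffs_norm s J (W J v) \<le> sqrt C * l2_norm v)"
proof -
  obtain B where "B \<ge> 0" "\<forall>v\<in>l2. coeffs_norm s J (W J v) \<le> B * l2_norm v"
    using analysis_bounded[of J] by auto
  \<comment> \<open>Synthesis gets its a priori bound from analysis by duality, with no separate
    estimate for subdivision.\<close>
  hence B: "\<forall>w\<in>coeffs_l2 s J. l2_norm (V J w) \<le> B * coeffs_norm s J w"
    using analysis_synthesis_bound_iff by blast
  have "(synthesis_norm s M b0 b J)\<^sup>2 \<le> C \<longleftrightarrow>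
      (\<forall>w\<in>coeffs_l2 s J. l2_norm (V J w) \<le> sqrt C * coeffs_norm s J w)"
    unfolding synthesis_norm_def
  proof (rule operator_norm_power2_le_iff[where z = "(\<lambda>_ _ _. 0, \<lambda>_. 0)" and sc = coeffs_scaleR and B = B])
    show "l2_norm (V J (coeffs_scaleR c w)) = \<bar>c\<bar> * l2_norm (V J w)" for c w
      by (simp add: synthesis_scaleR)
    show "coeffs_norm s J (\<lambda>_ _ _. 0, \<lambda>_. 0) = 0" by (simp add: coeffs_norm_def)
    show "(\<lambda>_ _ _. 0, \<lambda>_. 0) \<in> coeffs_l2 s J" by (simp add: coeffs_l2_def)
  qed (use B assms in \<open>simp_all add: coeffs_norm_scaleR coeffs_l2_scaleR\<close>)
  also have "\<dots> \<longleftrightarrow> (\<forall>v\<in>l2. coeffs_norm s J (W J v) \<le> sqrt C * l2_norm v)"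
    using assms by (intro analysis_synthesis_bound_iff) simp
  finally show ?thesis .
qed

lemma synthesis_norm_iff_analysis_norm:
  "0 \<le> C \<Longrightarrow> (synthesis_norm s M b0 b J)\<^sup>2 \<le> C \<longleftrightarrow> (analysis_norm s M b0 b J)\<^sup>2 \<le> C"
  by (simp only: analysis_norm_le_iff synthesis_norm_le_iff)

lemma analysis_norm_le_iff':
  assumes "0 \<le> C"
  shows "(analysis_norm s M b0 b J)\<^sup>2 \<le> C \<longleftrightarrow>
    (\<forall>v\<in>l2. (coeffs_norm s J (W J v))\<^sup>2 \<le> C * (l2_norm v)\<^sup>2)"
proof -
  have "x \<le> sqrt C * y \<longleftrightarrow> x\<^sup>2 \<le> C * y\<^sup>2" if "0 \<le> x" "0 \<le> y" for x y
  proof -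
    have "x \<le> sqrt C * y \<longleftrightarrow> x\<^sup>2 \<le> (sqrt C * y)\<^sup>2"
      using that assms by (intro power_mono_iff[symmetric]) auto
    thus ?thesis using assms by (simp add: power_mult_distrib)
  qed
  thus ?thesis unfolding analysis_norm_le_iff[OF assms] by simp
qed

end

section \<open>Reconstruction over all levels and the equivalences\<close>

lemma synthesis_analysis:
  fixes M :: "nat \<Rightarrow> int^'d^'d"
  assumes one: "\<And>u y. subdivision b0' (M 0) (transition b0 (M 0) u) y +
    (\<Sum>l=1..s. subdivision (b' l) (M l) (transition (b l) (M l) u) y) = u y"
  shows "synthesis s M b0' b' J (analysis s M b0 b J v) = v"
proof -
  \<comment> \<open>The coefficients stay those of the full \<open>J\<close>-level analysis while
    the starting level \<open>j\<close> varies. The condition \<open>j \<le> J\<close> keeps the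
    levels used away from the default value zero in \<open>analysis\<close>.\<close>
  have "synth_from s M b0' b' (fst (analysis s M b0 b J v)) j (low_pass b0 (M 0) v j) = v" if "j \<le> J" for j
    using that
  proof (induction j)
    case (Suc j)
    have "(\<lambda>n. subdivision b0' (M 0) (low_pass b0 (M 0) v (Suc j)) n +
        (\<Sum>l=1..s. subdivision (b' l) (M l) (fst (analysis s M b0 b J v) l (Suc j)) n)) = low_pass b0 (M 0) v j"
    proof
      fix n
      have "(\<Sum>l=1..s. subdivision (b' l) (M l) (fst (analysis s M b0 b J v) l (Suc j)) n) =
          (\<Sum>l=1..s. subdivision (b' l) (M l) (transition (b l) (M l) (low_pass b0 (M 0) v j)) n)"
        by (rule sum.cong) (use Suc.prems in \<open>auto simp: analysis_def\<close>)
      thus "subdivision b0' (M 0) (low_pass b0 (M 0) v (Suc j)) n +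
        (\<Sum>l=1..s. subdivision (b' l) (M l) (fst (analysis s M b0 b J v) l (Suc j)) n) = low_pass b0 (M 0) v j n"
        using one[of "low_pass b0 (M 0) v j" n] by simp
    qed
    thus ?case using Suc by simp
  qed simp
  from this[of J] show ?thesis by (simp add: synthesis_def analysis_def)
qed

theorem theorem2p6:
  fixes s :: nat
    and M :: "nat \<Rightarrow> int^'d^'d"
    and b0 b0' :: "int^'d \<Rightarrow> complex^'r^'r"
    and b b' :: "nat \<Rightarrow> int^'d \<Rightarrow> complex^'r^1"
    and C1 C2 :: real
  assumes "s \<ge> 1"
    and "fin_supp b0" and "fin_supp b0'"
    and "\<And>l. l \<in> {1..s} \<Longrightarrow> fin_supp (b l)"
    and "\<And>l. l \<in> {1..s} \<Longrightarrow> fin_supp (b' l)"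
    and "\<And>l. l \<le> s \<Longrightarrow> dilation_matrix (M l)"
    and "dual_framelet_filter_bank s M b0 b b0' b'"
    and "0 < C1" and "C1 \<le> C2"
  shows
    "((l2_stable s M b0 b \<and> l2_stable s M b0' b' \<and>
       l2_stability_bounds s M b0 b C1 C2 \<and>
       l2_stability_bounds s M b0' b' (inverse C2) (inverse C1))
      \<longleftrightarrow> (\<forall>J\<ge>1. (analysis_norm s M b0 b J)\<^sup>2 \<le> C2 \<and> (analysis_norm s M b0' b' J)\<^sup>2 \<le> inverse C1))
   \<and> ((\<forall>J\<ge>1. (analysis_norm s M b0 b J)\<^sup>2 \<le> C2 \<and> (analysis_norm s M b0' b' J)\<^sup>2 \<le> inverse C1)
      \<longleftrightarrow> (\<forall>J\<ge>1. (synthesis_norm s M b0 b J)\<^sup>2 \<le> C2 \<and> (synthesis_norm s M b0' b' J)\<^sup>2 \<le> inverse C1))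
   \<and> ((\<forall>J\<ge>1. (synthesis_norm s M b0 b J)\<^sup>2 \<le> C2 \<and> (synthesis_norm s M b0' b' J)\<^sup>2 \<le> inverse C1)
      \<longleftrightarrow> (\<forall>J\<ge>1. (synthesis_norm s M b0 b J)\<^sup>2 \<le> C2 \<and> (analysis_norm s M b0' b' J)\<^sup>2 \<le> inverse C1))
   \<and> ((\<forall>J\<ge>1. (synthesis_norm s M b0 b J)\<^sup>2 \<le> C2 \<and> (analysis_norm s M b0' b' J)\<^sup>2 \<le> inverse C1)
      \<longleftrightarrow> (\<forall>J\<ge>1. (analysis_norm s M b0 b J)\<^sup>2 \<le> C2 \<and> (synthesis_norm s M b0' b' J)\<^sup>2 \<le> inverse C1))"
proof -
  have det: "det (M l) \<noteq> 0" if "l \<le> s" for l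
    using assms(6)[OF that] by (rule dilation_matrix_det_nz)
  interpret F: filter_bank s M b0 b
    by unfold_locales (use assms(2,4) inj_int_matrix[OF det] in auto)
  interpret F': filter_bank s M b0' b'
    by unfold_locales (use assms(3,5) inj_int_matrix[OF det] in auto)
  have C: "0 < C1" "0 < C2" "0 \<le> C2" "0 \<le> inverse C1" using assms(8,9) by auto
  have recon: "F'.V J (F.W J v) = v" for J v
    by (rule synthesis_analysis, rule one_level_reconstruction[OF assms(7) det assms(2-5)])
  have mixed: "(l2_norm v)\<^sup>2 \<le> coeffs_norm s J (F'.W J v) * coeffs_norm s J (F.W J v)" if "v \<in> l2" for J v
  proof -
    have "(l2_norm v)\<^sup>2 = coeffs_ip s J (F'.W J v) (F.W J v)"
      using F'.ip_synthesis[OF that F.analysis_l2[OF that], of J] by (simp add: recon ip_self)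
    also have "\<dots> \<le> coeffs_norm s J (F'.W J v) * coeffs_norm s J (F.W J v)"
      by (rule coeffs_ip_Cauchy_Schwarz[OF F'.analysis_l2[OF that] F.analysis_l2[OF that]])
    finally show ?thesis .
  qed
  \<comment> \<open>Here \<open>n\<close> is the norm of \<open>v\<close> and \<open>x\<close>,
    \<open>y\<close> are the norms of its two analyses. Squaring the first inequality and inserting
    the bound for \<open>x\<close> leaves one factor \<open>n\<^sup>2\<close> to cancel, which is
    why \<open>n = 0\<close> is treated apart.\<close>
  have lower: "n\<^sup>2 \<le> c * y\<^sup>2" if "n\<^sup>2 \<le> x * y" "x\<^sup>2 \<le> c * n\<^sup>2" "0 \<le> c" for n x y c :: real
  proof (cases "n = 0")
    case False
    have "n\<^sup>2 * n\<^sup>2 \<le> (x * y)\<^sup>2"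
      unfolding power2_eq_square[symmetric] by (rule power_mono[OF that(1)]) simp
    also have "\<dots> \<le> (c * n\<^sup>2) * y\<^sup>2"
      unfolding power_mult_distrib using that(2) by (rule mult_right_mono) simp
    finally have "n\<^sup>2 * n\<^sup>2 \<le> n\<^sup>2 * (c * y\<^sup>2)" by (simp only: mult_ac)
    thus ?thesis by (rule mult_left_le_imp_le) (use False in simp)
  qed (use that(3) in simp)
  have "(l2_stable s M b0 b \<and> l2_stable s M b0' b' \<and>
       l2_stability_bounds s M b0 b C1 C2 \<and>
       l2_stability_bounds s M b0' b' (inverse C2) (inverse C1))
      \<longleftrightarrow> (\<forall>J\<ge>1. (analysis_norm s M b0 b J)\<^sup>2 \<le> C2 \<and> (analysis_norm s M b0' b' J)\<^sup>2 \<le> inverse C1)"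
    (is "?L \<longleftrightarrow> ?R")
  proof
    assume ?L
    thus ?R
      unfolding F.analysis_norm_le_iff'[OF C(3)] F'.analysis_norm_le_iff'[OF C(4)] l2_stability_bounds_def
      by blast
  next
    assume ?R
    hence up: "(coeffs_norm s J (F.W J v))\<^sup>2 \<le> C2 * (l2_norm v)\<^sup>2"
      "(coeffs_norm s J (F'.W J v))\<^sup>2 \<le> inverse C1 * (l2_norm v)\<^sup>2" if "J \<ge> 1" "v \<in> l2" for J v
      using that F.analysis_norm_le_iff'[OF C(3), of J] F'.analysis_norm_le_iff'[OF C(4), of J] by auto
    have "C1 * (l2_norm v)\<^sup>2 \<le> (coeffs_norm s J (F.W J v))\<^sup>2" if J: "J \<ge> 1" "v \<in> l2" for J v
      using lower[OF mixed[OF J(2)] up(2)[OF J] C(4)] C by (simp add: field_simps)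
    moreover have "inverse C2 * (l2_norm v)\<^sup>2 \<le> (coeffs_norm s J (F'.W J v))\<^sup>2" if J: "J \<ge> 1" "v \<in> l2" for J v
    proof -
      \<comment> \<open>The same inequality with its factors exchanged, so that now the upper bound
        of \<open>b\<close> yields the lower bound of \<open>b'\<close>.\<close>
      have "(l2_norm v)\<^sup>2 \<le> coeffs_norm s J (F.W J v) * coeffs_norm s J (F'.W J v)"
        using mixed[OF J(2), of J] by (simp only: mult.commute)
      from lower[OF this up(1)[OF J] C(3)] show ?thesis using C by (simp add: field_simps)
    qed
    ultimately have "l2_stability_bounds s M b0 b C1 C2"
      "l2_stability_bounds s M b0' b' (inverse C2) (inverse C1)"
      using up unfolding l2_stability_bounds_def by blast+
    moreover from this have "l2_stable s M b0 b" "l2_stable s M b0' b'"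
      using C unfolding l2_stable_def by (meson positive_imp_inverse_positive)+
    ultimately show ?L by blast
  qed
  thus ?thesis
    by (simp only: F.synthesis_norm_iff_analysis_norm[OF C(3)] F'.synthesis_norm_iff_analysis_norm[OF C(4)] simp_thms)
qed

end
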